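(* Let $X$ be an infinite-dimensional complex reflexive Banach space, and let $T\in\mathcal{B}(X)$. Then there exists $d\in\mathbb{N}$ such that for every $\varepsilon>0$ there is an operator $F\in\mathcal{B}(X)$ of rank $\leq d$ satisfying $\|F\|<\varepsilon$, and such that $T+F$ admits an invariant halfspace.
   Context: $\mathbb{N}=\{1,2,3,\dots\}$. $\mathcal{B}(X)$ is the algebra of bounded linear operators on $X$. A halfspace of a Banach space $X$ is a norm-closed subspace $Y$ with $\dim(Y)=\dim(X/Y)=\infty$. An invariant halfspace (IHS) under an operator $R\in\mathcal{B}(X)$ is a halfspace $Y$ of $X$ with $RY\subseteq Y$; "$R$ admits an IHS" means that such a $Y$ exists. *)

theory Defs
  imports "HOL-Analysis.Analysis"
begin

section \<open>Complex Banach spaces\<close>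

class complex_vector = real_vector +
  fixes scaleC :: "complex \<Rightarrow> 'a \<Rightarrow> 'a"  (infixr "*\<^sub>C" 75)
  assumes scaleC_add_right: "a *\<^sub>C (x + y) = a *\<^sub>C x + a *\<^sub>C y"
    and scaleC_add_left: "(a + b) *\<^sub>C x = a *\<^sub>C x + b *\<^sub>C x"
    and scaleC_scaleC: "a *\<^sub>C (b *\<^sub>C x) = (a * b) *\<^sub>C x"
    and scaleC_one: "1 *\<^sub>C x = x"
    and scaleC_of_real: "complex_of_real r *\<^sub>C x = r *\<^sub>R x"

class complex_normed_vector = complex_vector + real_normed_vector +
  assumes norm_scaleC: "norm (a *\<^sub>C x) = cmod a * norm x"

class complex_banach = complex_normed_vector + banach

global_interpretation complex_vector:
  vector_space "scaleC :: complex \<Rightarrow> 'a \<Rightarrow> 'a::complex_vector"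
  defines csubspace = complex_vector.subspace
    and cspan = complex_vector.span
    and cdim = complex_vector.dim
  by unfold_locales
    (simp_all add: scaleC_add_right scaleC_add_left scaleC_scaleC scaleC_one)

lemma scaleC_scaleR_commute: "a *\<^sub>C r *\<^sub>R x = r *\<^sub>R a *\<^sub>C x"
  by (metis complex_vector.scale_left_commute scaleC_of_real)

instantiation complex :: complex_banach
begin

definition scaleC_complex :: "complex \<Rightarrow> complex \<Rightarrow> complex"
  where "scaleC_complex a x = a * x"

instance
  by standard
    (simp_all add: scaleC_complex_def algebra_simps norm_mult scaleR_conv_of_real)

end


section \<open>Bounded complex-linear operators\<close>

typedef (overloaded) ('a, 'b) cblinfun =
  "{T :: 'a::complex_normed_vector \<Rightarrow>\<^sub>L 'b::complex_normed_vector.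
     \<forall>c x. blinfun_apply T (c *\<^sub>C x) = c *\<^sub>C blinfun_apply T x}"
  morphisms blinfun_of_cblinfun Cblinfun
proof
  show "0 \<in> {T :: 'a \<Rightarrow>\<^sub>L 'b.
     \<forall>c x. blinfun_apply T (c *\<^sub>C x) = c *\<^sub>C blinfun_apply T x}"
    by simp
qed

type_notation cblinfun  ("(_ \<Rightarrow>\<^sub>C\<^sub>L /_)" [22, 21] 21)

setup_lifting type_definition_cblinfun

lift_definition cblinfun_apply ::
  "('a::complex_normed_vector \<Rightarrow>\<^sub>C\<^sub>L 'b::complex_normed_vector) \<Rightarrow> 'a \<Rightarrow> 'b"
  is blinfun_apply .

text \<open>The norm is inherited from \<^typ>\<open>'a \<Rightarrow>\<^sub>L 'b\<close>, hence is the operator norm.\<close>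

instantiation cblinfun :: (complex_normed_vector, complex_normed_vector) complex_normed_vector
begin

lift_definition zero_cblinfun :: "'a \<Rightarrow>\<^sub>C\<^sub>L 'b" is 0
  by simp

lift_definition plus_cblinfun :: "'a \<Rightarrow>\<^sub>C\<^sub>L 'b \<Rightarrow> 'a \<Rightarrow>\<^sub>C\<^sub>L 'b \<Rightarrow> 'a \<Rightarrow>\<^sub>C\<^sub>L 'b" is "(+)"
  by (simp add: blinfun.add_left complex_vector.scale_right_distrib)

lift_definition minus_cblinfun :: "'a \<Rightarrow>\<^sub>C\<^sub>L 'b \<Rightarrow> 'a \<Rightarrow>\<^sub>C\<^sub>L 'b \<Rightarrow> 'a \<Rightarrow>\<^sub>C\<^sub>L 'b" is "(-)"
  by (simp add: blinfun.diff_left complex_vector.scale_right_diff_distrib)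

lift_definition uminus_cblinfun :: "'a \<Rightarrow>\<^sub>C\<^sub>L 'b \<Rightarrow> 'a \<Rightarrow>\<^sub>C\<^sub>L 'b" is "uminus"
  by (simp add: blinfun.minus_left)

lift_definition scaleR_cblinfun :: "real \<Rightarrow> 'a \<Rightarrow>\<^sub>C\<^sub>L 'b \<Rightarrow> 'a \<Rightarrow>\<^sub>C\<^sub>L 'b" is "(*\<^sub>R)"
  by (simp add: blinfun.scaleR_left scaleC_scaleR_commute)

lemma bounded_linear_scaleC_blinfun:
  "bounded_linear (\<lambda>x. a *\<^sub>C blinfun_apply T x)"
  for T :: "'a \<Rightarrow>\<^sub>L 'b"
proof (rule bounded_linear_intro)
  show "norm (a *\<^sub>C blinfun_apply T x) \<le> norm x * (cmod a * norm T)" for x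
    using mult_left_mono[OF norm_blinfun[of T x] norm_ge_zero[of a]]
    by (simp add: norm_scaleC ac_simps)
qed (simp_all add: blinfun.add_right blinfun.scaleR_right scaleC_add_right scaleC_scaleR_commute)

lift_definition scaleC_cblinfun :: "complex \<Rightarrow> 'a \<Rightarrow>\<^sub>C\<^sub>L 'b \<Rightarrow> 'a \<Rightarrow>\<^sub>C\<^sub>L 'b"
  is "\<lambda>a T. Blinfun (\<lambda>x. a *\<^sub>C blinfun_apply T x)"
  by (simp add: bounded_linear_Blinfun_apply[OF bounded_linear_scaleC_blinfun]
      complex_vector.scale_left_commute)

lift_definition norm_cblinfun :: "'a \<Rightarrow>\<^sub>C\<^sub>L 'b \<Rightarrow> real" is norm .

lift_definition dist_cblinfun :: "'a \<Rightarrow>\<^sub>C\<^sub>L 'b \<Rightarrow> 'a \<Rightarrow>\<^sub>C\<^sub>L 'b \<Rightarrow> real" is dist .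

definition sgn_cblinfun :: "'a \<Rightarrow>\<^sub>C\<^sub>L 'b \<Rightarrow> 'a \<Rightarrow>\<^sub>C\<^sub>L 'b"
  where "sgn_cblinfun T = inverse (norm T) *\<^sub>R T"

definition uniformity_cblinfun :: "(('a \<Rightarrow>\<^sub>C\<^sub>L 'b) \<times> ('a \<Rightarrow>\<^sub>C\<^sub>L 'b)) filter"
  where "uniformity_cblinfun = (INF e\<in>{0<..}. principal {(S, T). dist S T < e})"

definition open_cblinfun :: "('a \<Rightarrow>\<^sub>C\<^sub>L 'b) set \<Rightarrow> bool"
  where "open_cblinfun U \<longleftrightarrow>
    (\<forall>S\<in>U. eventually (\<lambda>(S', T). S' = S \<longrightarrow> T \<in> U) uniformity)"

instance
proof
  fix S T U :: "'a \<Rightarrow>\<^sub>C\<^sub>L 'b" and a b :: complex and r s :: real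
  note reps = zero_cblinfun.rep_eq plus_cblinfun.rep_eq minus_cblinfun.rep_eq
    uminus_cblinfun.rep_eq scaleR_cblinfun.rep_eq
    norm_cblinfun.rep_eq dist_cblinfun.rep_eq
  note inj = blinfun_of_cblinfun_inject[symmetric]
  have blinfun_ext: "f = g \<longleftrightarrow> (\<forall>x. blinfun_apply f x = blinfun_apply g x)"
    for f g :: "'a \<Rightarrow>\<^sub>L 'b"
    by (auto intro: blinfun_eqI)
  have scaleC_apply:
    "blinfun_apply (blinfun_of_cblinfun (a *\<^sub>C S)) x = a *\<^sub>C blinfun_apply (blinfun_of_cblinfun S) x"
    for a x and S :: "'a \<Rightarrow>\<^sub>C\<^sub>L 'b"
    by (simp add: scaleC_cblinfun.rep_eq bounded_linear_Blinfun_apply[OF bounded_linear_scaleC_blinfun])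
  show "S + T + U = S + (T + U)" "S + T = T + S" "0 + S = S" "- S + S = 0" "S - T = S + - T"
    "r *\<^sub>R (S + T) = r *\<^sub>R S + r *\<^sub>R T" "(r + s) *\<^sub>R S = r *\<^sub>R S + s *\<^sub>R S"
    "r *\<^sub>R s *\<^sub>R S = (r * s) *\<^sub>R S" "1 *\<^sub>R S = S"
    by (simp_all add: inj reps scaleR_add_right scaleR_add_left ac_simps)
  show "a *\<^sub>C (S + T) = a *\<^sub>C S + a *\<^sub>C T" "(a + b) *\<^sub>C S = a *\<^sub>C S + b *\<^sub>C S"
    "a *\<^sub>C b *\<^sub>C S = (a * b) *\<^sub>C S" "1 *\<^sub>C S = S" "complex_of_real r *\<^sub>C S = r *\<^sub>R S"
    by (simp_all add: inj reps blinfun_ext scaleC_apply blinfun.add_left blinfun.scaleR_left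
        scaleC_add_left scaleC_add_right scaleC_of_real)
  show "dist S T = norm (S - T)"
    by (simp add: reps dist_norm)
  show "sgn S = inverse (norm S) *\<^sub>R S"
    by (rule sgn_cblinfun_def)
  show "uniformity = (INF e\<in>{0<..}. principal {(S, T :: 'a \<Rightarrow>\<^sub>C\<^sub>L 'b). dist S T < e})"
    by (rule uniformity_cblinfun_def)
  show "open U = (\<forall>S\<in>U. eventually (\<lambda>(S', T). S' = S \<longrightarrow> T \<in> U) uniformity)"
    for U :: "('a \<Rightarrow>\<^sub>C\<^sub>L 'b) set"
    by (rule open_cblinfun_def)
  show "norm S = 0 \<longleftrightarrow> S = 0" "norm (S + T) \<le> norm S + norm T" "norm (r *\<^sub>R S) = \<bar>r\<bar> * norm S"
    by (simp_all add: inj reps norm_triangle_ineq)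
  have le: "norm (a *\<^sub>C S) \<le> cmod a * norm S" for a and S :: "'a \<Rightarrow>\<^sub>C\<^sub>L 'b"
    unfolding reps
  proof (rule norm_blinfun_bound)
    let ?S = "blinfun_of_cblinfun S"
    show "norm (blinfun_apply (blinfun_of_cblinfun (a *\<^sub>C S)) x)
        \<le> cmod a * norm ?S * norm x" for x
      using mult_left_mono[OF norm_blinfun[of ?S x] norm_ge_zero[of a]]
      by (simp add: scaleC_apply norm_scaleC ac_simps)
  qed simp
  show "norm (a *\<^sub>C S) = cmod a * norm S"
  proof (cases "a = 0")
    case True
    then show ?thesis
      using le[of 0 S] by (simp add: norm_cblinfun.rep_eq)
  next
    case False
    have "S = inverse a *\<^sub>C (a *\<^sub>C S)"
      using False by (simp add: inj blinfun_ext scaleC_apply)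
    then have "norm S \<le> inverse (cmod a) * norm (a *\<^sub>C S)"
      using le[of "inverse a" "a *\<^sub>C S"] by (simp add: norm_inverse)
    then have "cmod a * norm S \<le> norm (a *\<^sub>C S)"
      using False by (simp add: field_simps)
    then show ?thesis
      using le[of a S] by simp
  qed
qed

end


section \<open>Reflexivity\<close>

lemma bounded_linear_cblinfun_eval:
  "bounded_linear (\<lambda>f :: 'a::complex_normed_vector \<Rightarrow>\<^sub>C\<^sub>L 'b::complex_normed_vector. cblinfun_apply f x)"
proof (rule bounded_linear_intro)
  show "norm (cblinfun_apply f x) \<le> norm f * norm x" for f :: "'a \<Rightarrow>\<^sub>C\<^sub>L 'b"
    by (simp add: cblinfun_apply.rep_eq norm_cblinfun.rep_eq norm_blinfun)
qed (simp_all add: cblinfun_apply.rep_eq plus_cblinfun.rep_eq scaleR_cblinfun.rep_eq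
      blinfun.add_left blinfun.scaleR_left)

lemma cblinfun_apply_scaleC_left: "cblinfun_apply (a *\<^sub>C f) x = a *\<^sub>C cblinfun_apply f x"
  by transfer (simp add: bounded_linear_Blinfun_apply[OF bounded_linear_scaleC_blinfun])

lift_definition bidual_embedding ::
  "'a::complex_normed_vector \<Rightarrow> (('a \<Rightarrow>\<^sub>C\<^sub>L complex) \<Rightarrow>\<^sub>C\<^sub>L complex)"
  is "\<lambda>x. Blinfun (\<lambda>f. cblinfun_apply f x)"
  by (simp add: bounded_linear_Blinfun_apply[OF bounded_linear_cblinfun_eval]
      cblinfun_apply_scaleC_left)

lemma bidual_embedding_apply:
  "cblinfun_apply (bidual_embedding x) f = cblinfun_apply f x"
  by (simp add: bidual_embedding.rep_eq cblinfun_apply.rep_eq[of "bidual_embedding x"]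
      bounded_linear_Blinfun_apply[OF bounded_linear_cblinfun_eval])

definition reflexive :: "'a::complex_normed_vector itself \<Rightarrow> bool"
  where "reflexive _ \<longleftrightarrow>
    surj (bidual_embedding :: 'a \<Rightarrow> (('a \<Rightarrow>\<^sub>C\<^sub>L complex) \<Rightarrow>\<^sub>C\<^sub>L complex))"


section \<open>Dimension, rank, and invariant halfspaces\<close>

text \<open>Since \<^const>\<open>cdim\<close> takes the value \<open>0\<close> on infinite-dimensional subspaces,
  finite-dimensionality has to be recorded separately.\<close>

definition finite_cdim :: "'a::complex_vector set \<Rightarrow> bool"
  where "finite_cdim V \<longleftrightarrow> (\<exists>B. finite B \<and> B \<subseteq> V \<and> cspan B = V)"

text \<open>The quotient by \<open>Y\<close> is the space of cosets \<open>x + Y\<close>. A linear combination of the cosets of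
  elements of \<open>B\<close> is the coset of the same linear combination of these elements, so the
  formula below says that finitely many cosets span the quotient.\<close>

definition finite_cdim_quotient :: "'a::complex_vector set \<Rightarrow> bool"
  where "finite_cdim_quotient Y \<longleftrightarrow>
    (\<exists>B. finite B \<and> (\<forall>x. \<exists>b\<in>cspan B. (+) x ` Y = (+) b ` Y))"

definition halfspace :: "'a::complex_normed_vector set \<Rightarrow> bool"
  where "halfspace Y \<longleftrightarrow>
    csubspace Y \<and> closed Y \<and> \<not> finite_cdim Y \<and> \<not> finite_cdim_quotient Y"

definition admits_IHS :: "('a::complex_normed_vector \<Rightarrow>\<^sub>C\<^sub>L 'a) \<Rightarrow> bool"
  where "admits_IHS R \<longleftrightarrow> (\<exists>Y. halfspace Y \<and> cblinfun_apply R ` Y \<subseteq> Y)"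

definition rank_le ::
  "('a::complex_normed_vector \<Rightarrow>\<^sub>C\<^sub>L 'b::complex_normed_vector) \<Rightarrow> nat \<Rightarrow> bool"
  where "rank_le F d \<longleftrightarrow>
    finite_cdim (range (cblinfun_apply F)) \<and> cdim (range (cblinfun_apply F)) \<le> d"

end

theory Submission
  imports Defs "HOL-Complex_Analysis.Complex_Analysis"
begin

text \<open>The perturbation is produced in two steps, a correction of bounded rank followed by a rank-one correction.

  Choose a point \<open>m\<close> of the Weyl spectrum of \<open>T\<close>: it lies in the spectrum of
  \<open>T + F\<close> for every \<open>F\<close> of finite rank. Such a point exists
  (\<open>weyl_spectrum_nonempty\<close>), since otherwise a functional on the operator algebra that
  vanishes on finite-rank operators would turn the inverses of the operators \<open>T + F - m\<close> into
  a nonzero entire function that vanishes at infinity. If the eigenvectors or the eigenfunctionals of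
  \<open>T\<close> for \<open>m\<close> span an infinite-dimensional space, then every second member of a
  biorthogonal sequence of them already gives an invariant halfspace. Otherwise a small operator that maps
  eigenvectors onto vectors dual to the eigenfunctionals removes \<open>m\<close> from the eigenvalues of
  \<open>T\<close> or from those of its adjoint (\<open>IHS_or_small_injectivity\<close>). Its rank is at
  most the smaller of the two dimensions, and this is why the bound \<open>d\<close>, which is one more
  than that, depends on \<open>T\<close> but not on \<open>\<epsilon>\<close>. By the choice of
  \<open>m\<close>, the new operator \<open>S\<close> still has \<open>m\<close> in its spectrum.

  Next, suppose that some boundary point \<open>n\<close> of the spectrum of \<open>S\<close> is not an
  eigenvalue of \<open>S\<close>. The resolvents at points \<open>l k\<close> outside the spectrum that
  tend to \<open>n\<close> are unbounded, so by uniform boundedness they are unbounded on a single vector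
  \<open>y\<close>. After passing to a subsequence, normalizing the resolvents applied to \<open>y\<close>
  gives unit vectors with \<open>S a = l k a + c k y\<close> and \<open>c k\<close> tending to 0.
  Reflexivity and injectivity of \<open>S - n\<close> force these vectors to be weakly null, so along a
  subsequence they belong to a biorthogonal system and some functional \<open>f\<close> of small norm
  takes exactly the values \<open>- c k\<close> on them. Then \<open>x \<mapsto> S x + f(x) y\<close> has
  all of these vectors as eigenvectors (\<open>rank_one_perturbation\<close>). If \<open>n\<close> is not
  an eigenvalue of the adjoint, the same argument in the dual space applies; to cover both cases at once
  it is carried out for an abstract dual pair.

  In the remaining case every boundary point of the spectrum of \<open>S\<close> is an eigenvalue of both
  \<open>S\<close> and its adjoint. Then \<open>m\<close> is an interior point, so the boundary is
  infinite, and because eigenvectors and eigenfunctionals for different eigenvalues annihilate each other,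
  the common kernel of every second eigenfunctional is a halfspace invariant under \<open>S\<close>
  itself.\<close>

section \<open>The Hahn--Banach theorem\<close>

definition sublinear :: "('v::real_vector \<Rightarrow> real) \<Rightarrow> bool" where
  "sublinear p \<longleftrightarrow>
    (\<forall>x y. p (x + y) \<le> p x + p y) \<and> (\<forall>r x. r > 0 \<longrightarrow> p (r *\<^sub>R x) \<le> r * p x)"

lemma sublinearI:
  assumes "\<And>x y. p (x + y) \<le> p x + p y" "\<And>r x. r > 0 \<Longrightarrow> p (r *\<^sub>R x) \<le> r * p x"
  shows "sublinear p"
  using assms by (simp add: sublinear_def)

lemma sublinear_add: "sublinear p \<Longrightarrow> p (x + y) \<le> p x + p y"
  by (simp add: sublinear_def)

lemma sublinear_scale:
  assumes "sublinear p" "r > 0"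
  shows "p (r *\<^sub>R x) = r * p x"
proof (rule antisym)
  show "p (r *\<^sub>R x) \<le> r * p x"
    using assms by (simp add: sublinear_def)
  have "p (inverse r *\<^sub>R (r *\<^sub>R x)) \<le> inverse r * p (r *\<^sub>R x)"
    using assms unfolding sublinear_def by (metis positive_imp_inverse_positive)
  then show "r * p x \<le> p (r *\<^sub>R x)"
    using assms(2) by (simp add: field_simps)
qed

lemma sublinear_zero:
  assumes "sublinear p"
  shows "p 0 = 0"
  using sublinear_scale[OF assms, of 2 0] by simp

lemma sublinear_lower:
  assumes "sublinear p"
  shows "- p (- x) \<le> p x"
  using sublinear_add[OF assms, of x "- x"] sublinear_zero[OF assms] by simp

text \<open>Replacing \<open>p x\<close> by the infimum of \<open>p (x + t v) - t p v\<close> over \<open>t \<ge>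
  0\<close> makes \<open>p\<close> as linear as possible in the direction \<open>v\<close>. A minimal
  sublinear functional is unchanged by this, hence odd, hence linear.\<close>

lemma sublinear_flatten:
  assumes p: "sublinear p"
  obtains q where "sublinear q" "\<And>x. q x \<le> p x" "q (- v) \<le> - p v"
proof -
  define S where "S x = (\<lambda>t. p (x + t *\<^sub>R v) - t * p v) ` {0..}" for x
  define q where "q x = Inf (S x)" for x
  \<comment> \<open>The infimum is finite because of this bound, which does not involve \<open>t\<close>.\<close>
  have lower: "- p (- x) \<le> p (x + t *\<^sub>R v) - t * p v" if "t \<ge> 0" for x t
  proof -
    have "p (t *\<^sub>R v) = t * p v"
      using sublinear_scale[OF p, of t v] sublinear_zero[OF p] that
      by (cases "t = 0") auto
    moreover have "p (t *\<^sub>R v) \<le> p (x + t *\<^sub>R v) + p (- x)"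
      using sublinear_add[OF p, of "x + t *\<^sub>R v" "- x"] by simp
    ultimately show ?thesis by simp
  qed
  have bdd: "bdd_below (S x)" for x
    unfolding S_def using lower by (intro bdd_belowI2[where m = "- p (- x)"]) auto
  have q_le: "q x \<le> p (x + t *\<^sub>R v) - t * p v" if "t \<ge> 0" for x t
    unfolding q_def using that by (intro cInf_lower bdd) (auto simp: S_def)
  have q_near: "\<exists>t\<ge>0. p (x + t *\<^sub>R v) - t * p v < q x + e" if "e > 0" for x e
  proof -
    have "\<exists>s\<in>S x. s < q x + e"
      using cInf_lessD[of "S x" "q x + e"] that unfolding q_def S_def by auto
    then show ?thesis by (auto simp: S_def)
  qed
  have "sublinear q"
  proof (rule sublinearI)
    show "q (x + y) \<le> q x + q y" for x y
    proof (rule field_le_epsilon)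
      fix e :: real assume "e > 0"
      then obtain s t where s: "s \<ge> 0" "p (x + s *\<^sub>R v) - s * p v < q x + e / 2"
        and t: "t \<ge> 0" "p (y + t *\<^sub>R v) - t * p v < q y + e / 2"
        using q_near[of "e / 2"] by (metis half_gt_zero)
      have "q (x + y) \<le> p ((x + y) + (s + t) *\<^sub>R v) - (s + t) * p v"
        using s t by (intro q_le) auto
      also have "(x + y) + (s + t) *\<^sub>R v = (x + s *\<^sub>R v) + (y + t *\<^sub>R v)"
        by (simp add: algebra_simps)
      also have "p \<dots> - (s + t) * p v \<le> (p (x + s *\<^sub>R v) - s * p v) + (p (y + t *\<^sub>R v) - t * p v)"
        using sublinear_add[OF p, of "x + s *\<^sub>R v" "y + t *\<^sub>R v"] by (simp add: distrib_right)
      also have "\<dots> \<le> q x + q y + e" using s t by simp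
      finally show "q (x + y) \<le> q x + q y + e" .
    qed
    show "q (r *\<^sub>R x) \<le> r * q x" if r: "r > 0" for r x
    proof (rule field_le_epsilon)
      fix e :: real assume "e > 0"
      then obtain s where s: "s \<ge> 0" "p (x + s *\<^sub>R v) - s * p v < q x + e / r"
        using q_near[of "e / r"] r by (metis divide_pos_pos)
      have "q (r *\<^sub>R x) \<le> p (r *\<^sub>R x + (r * s) *\<^sub>R v) - (r * s) * p v"
        using s r by (intro q_le) auto
      also have "r *\<^sub>R x + (r * s) *\<^sub>R v = r *\<^sub>R (x + s *\<^sub>R v)"
        by (simp add: algebra_simps)
      also have "p \<dots> - (r * s) * p v = r * (p (x + s *\<^sub>R v) - s * p v)"
        by (simp only: sublinear_scale[OF p r] right_diff_distrib mult.assoc)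
      also have "\<dots> \<le> r * (q x + e / r)" using s r by (intro mult_left_mono) auto
      also have "\<dots> = r * q x + e" using r by (simp add: field_simps)
      finally show "q (r *\<^sub>R x) \<le> r * q x + e" .
    qed
  qed
  moreover have "q x \<le> p x" for x using q_le[of 0 x] by simp
  moreover have "q (- v) \<le> - p v" using q_le[of 1 "- v"] sublinear_zero[OF p] by simp
  ultimately show ?thesis using that by blast
qed

text \<open>The pointwise infimum of a chain of sublinear functionals below \<open>p\<close> is sublinear, and finite
  because all of them are bounded below by \<open>- p (- x)\<close>.\<close>

lemma minimal_sublinear_exists:
  assumes p: "sublinear p"
  obtains m where "sublinear m" "\<And>x. m x \<le> p x"
    "\<And>q. sublinear q \<Longrightarrow> (\<And>x. q x \<le> m x) \<Longrightarrow> q = m"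
proof -
  define A where "A = {q. sublinear q \<and> (\<forall>x. q x \<le> p x)}"
  define R where "R q q' \<longleftrightarrow> (\<forall>x. q' x \<le> q x)" for q q' :: "'a \<Rightarrow> real"
  have po: "partial_order_on A (relation_of R A)"
    unfolding R_def
    by (rule partial_order_on_relation_ofI) (auto intro: order_trans simp: fun_eq_iff antisym)
  have "\<exists>m\<in>A. \<forall>a\<in>A. R m a \<longrightarrow> a = m"
  proof (rule predicate_Zorn[OF po])
    fix C assume C: "C \<in> Chains (relation_of R A)"
    have CA: "C \<subseteq> A" using C by (auto simp: Chains_def relation_of_def)
    have chain: "R q q' \<or> R q' q" if "q \<in> C" "q' \<in> C" for q q'
      using C that by (auto simp: Chains_def relation_of_def)
    show "\<exists>u\<in>A. \<forall>a\<in>C. R a u"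
    proof (cases "C = {}")
      case True
      then show ?thesis using p by (auto simp: A_def)
    next
      case False
      define u where "u x = (INF q\<in>C. q x)" for x
      have lower: "- p (- x) \<le> q x" if "q \<in> C" for q x
      proof -
        have "sublinear q" "q (- x) \<le> p (- x)" using that CA by (auto simp: A_def)
        then show ?thesis using sublinear_lower[of q x] by simp
      qed
      have bdd: "bdd_below ((\<lambda>q. q x) ` C)" for x
        using lower by (intro bdd_belowI2[where m = "- p (- x)"]) auto
      have u_le: "u x \<le> q x" if "q \<in> C" for q x
        unfolding u_def using that bdd by (intro cINF_lower)
      have u_near: "\<exists>q\<in>C. q x < u x + e" if "e > 0" for x e
        using that cINF_less_iff[OF False bdd, of x "u x + e"] unfolding u_def by simp
      have "sublinear u"
      proof (rule sublinearI)
        show "u (x + y) \<le> u x + u y" for x y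
        proof (rule field_le_epsilon)
          fix e :: real assume "e > 0"
          then obtain q q' where q: "q \<in> C" "q x < u x + e / 2" and q': "q' \<in> C" "q' y < u y + e / 2"
            using u_near[of "e / 2"] by (metis half_gt_zero)
          obtain s where s: "s \<in> C" "\<And>z. s z \<le> q z" "\<And>z. s z \<le> q' z"
            using chain[OF q(1) q'(1)] q q' unfolding R_def by blast
          have "u (x + y) \<le> s x + s y"
            using u_le[OF s(1), of "x + y"] sublinear_add[of s x y] s(1) CA by (force simp: A_def)
          also have "\<dots> \<le> q x + q' y" using s by (simp add: add_mono)
          finally show "u (x + y) \<le> u x + u y + e" using q q' by simp
        qed
        show "u (r *\<^sub>R x) \<le> r * u x" if r: "r > 0" for r x
        proof (rule field_le_epsilon)
          fix e :: real assume "e > 0"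
          then obtain q where q: "q \<in> C" "q x < u x + e / r"
            using u_near[of "e / r"] r by (metis divide_pos_pos)
          have "u (r *\<^sub>R x) \<le> r * q x"
            using u_le[OF q(1), of "r *\<^sub>R x"] sublinear_scale[of q r x] q(1) CA r by (force simp: A_def)
          also have "\<dots> \<le> r * (u x + e / r)" using q r by (intro mult_left_mono) auto
          also have "\<dots> = r * u x + e" using r by (simp add: field_simps)
          finally show "u (r *\<^sub>R x) \<le> r * u x + e" .
        qed
      qed
      moreover have "u x \<le> p x" for x
        using False u_le CA by (force simp: A_def intro: order_trans)
      ultimately show ?thesis using u_le by (auto simp: A_def R_def)
    qed
  qed
  then obtain m where m: "m \<in> A" "\<And>a. a \<in> A \<Longrightarrow> R m a \<Longrightarrow> a = m" by blast
  show ?thesis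
  proof (rule that)
    show "sublinear m" "\<And>x. m x \<le> p x" using m(1) by (auto simp: A_def)
    show "q = m" if "sublinear q" "\<And>x. q x \<le> m x" for q
      using m(1) that by (intro m(2)) (auto simp: A_def R_def intro: order_trans)
  qed
qed

text \<open>Prescribing the value at a single vector replaces the extension from a subspace: the flattening in the
  direction \<open>v\<close> forces \<open>L v = p v\<close>, and a minimal functional below it is linear.\<close>

theorem hahn_banach_sublinear:
  assumes p: "sublinear p"
  obtains L where "linear L" "\<And>x. L x \<le> p x" "L v = p v"
proof -
  obtain q where q: "sublinear q" "\<And>x. q x \<le> p x" "q (- v) \<le> - p v"
    using sublinear_flatten[OF p, of v] by metis
  obtain L where L: "sublinear L" "\<And>x. L x \<le> q x"
    and min: "\<And>r. sublinear r \<Longrightarrow> (\<And>x. r x \<le> L x) \<Longrightarrow> r = L"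
    using minimal_sublinear_exists[OF q(1)] by metis
  have odd: "L (- x) = - L x" for x
  proof -
    obtain r where r: "sublinear r" "\<And>x. r x \<le> L x" "r (- x) \<le> - L x"
      using sublinear_flatten[OF L(1), of x] by metis
    then have "L (- x) \<le> - L x" using min by metis
    then show ?thesis using sublinear_lower[OF L(1), of x] by simp
  qed
  have "linear L"
  proof (rule linearI)
    show "L (x + y) = L x + L y" for x y
      using sublinear_add[OF L(1), of x y] sublinear_add[OF L(1), of "- x" "- y"]
        odd[of "x + y"] odd[of x] odd[of y] by simp
    show "L (r *\<^sub>R x) = r *\<^sub>R L x" for r x
    proof (cases r "0 :: real" rule: linorder_cases)
      case less
      then have "L (- (- r *\<^sub>R x)) = - (- r * L x)"
        using odd sublinear_scale[OF L(1), of "- r" x] by simp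
      then show ?thesis by simp
    qed (use sublinear_scale[OF L(1)] sublinear_zero[OF L(1)] in auto)
  qed
  moreover have "L x \<le> p x" for x using L(2) q(2) order_trans by blast
  moreover have "L v = p v"
  proof (rule antisym)
    show "p v \<le> L v" using L(2)[of "- v"] q(3) odd[of v] by simp
  qed (use calculation(2) in auto)
  ultimately show ?thesis using that by blast
qed

section \<open>Operators and complex functionals\<close>

lemma apply_add [simp]: "cblinfun_apply (S + T) x = cblinfun_apply S x + cblinfun_apply T x"
  by transfer (simp add: blinfun.add_left)

lemma apply_diff [simp]: "cblinfun_apply (S - T) x = cblinfun_apply S x - cblinfun_apply T x"
  by transfer (simp add: blinfun.diff_left)

lemma apply_uminus [simp]: "cblinfun_apply (- T) x = - cblinfun_apply T x"
  by transfer (simp add: blinfun.minus_left)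

lemma apply_zero [simp]: "cblinfun_apply 0 x = 0"
  by transfer simp

declare cblinfun_apply_scaleC_left [simp]

lemma bounded_linear_apply: "bounded_linear (cblinfun_apply T)"
  by transfer (rule blinfun.bounded_linear_right)

lemma apply_scaleC [simp]: "cblinfun_apply T (c *\<^sub>C x) = c *\<^sub>C cblinfun_apply T x"
  by transfer simp

lemmas apply_simps [simp] =
  linear_add[OF bounded_linear.linear[OF bounded_linear_apply]]
  linear_diff[OF bounded_linear.linear[OF bounded_linear_apply]]
  linear_neg[OF bounded_linear.linear[OF bounded_linear_apply]]
  linear_0[OF bounded_linear.linear[OF bounded_linear_apply]]
  linear_scale[OF bounded_linear.linear[OF bounded_linear_apply]]

lemma apply_sum: "cblinfun_apply T (\<Sum>i\<in>I. g i) = (\<Sum>i\<in>I. cblinfun_apply T (g i))"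
  by (rule linear_sum[OF bounded_linear.linear[OF bounded_linear_apply]])

lemma norm_apply_le: "norm (cblinfun_apply T x) \<le> norm T * norm x"
  by transfer (rule norm_blinfun)

lemma cblinfun_eqI: "(\<And>x. cblinfun_apply S x = cblinfun_apply T x) \<Longrightarrow> S = T"
  by transfer (rule blinfun_eqI)

lemma norm_cblinfun_le:
  "C \<ge> 0 \<Longrightarrow> (\<And>x. norm (cblinfun_apply T x) \<le> C * norm x) \<Longrightarrow> norm T \<le> C"
  by transfer (rule norm_blinfun_bound)

lemma cblinfun_ex:
  assumes "\<And>x y. f (x + y) = f x + f y" "\<And>c x. f (c *\<^sub>C x) = c *\<^sub>C f x"
    "\<And>x. norm (f x) \<le> C * norm x"
  obtains T where "\<And>x. cblinfun_apply T x = f x"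
proof -
  have bl: "bounded_linear f"
  proof (rule bounded_linear_intro[where K = C])
    show "f (r *\<^sub>R x) = r *\<^sub>R f x" for r x
      using assms(2)[of "complex_of_real r" x] by (simp add: scaleC_of_real)
  qed (use assms in \<open>auto simp: mult.commute\<close>)
  have "cblinfun_apply (Cblinfun (Blinfun f)) x = f x" for x
    using assms(2) by (simp add: cblinfun_apply.rep_eq Cblinfun_inverse bounded_linear_Blinfun_apply[OF bl])
  then show ?thesis using that by blast
qed

lift_definition cblinfun_compose ::
  "('b::complex_normed_vector \<Rightarrow>\<^sub>C\<^sub>L 'c::complex_normed_vector) \<Rightarrow> ('a::complex_normed_vector \<Rightarrow>\<^sub>C\<^sub>L 'b) \<Rightarrow> ('a \<Rightarrow>\<^sub>C\<^sub>L 'c)"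
  (infixl "o\<^sub>C" 67) is "blinfun_compose"
  by simp

lemma apply_compose [simp]: "cblinfun_apply (S o\<^sub>C T) x = cblinfun_apply S (cblinfun_apply T x)"
  by transfer simp

lemma norm_compose_le: "norm (S o\<^sub>C T) \<le> norm S * norm T"
  by transfer (rule norm_blinfun_compose)

lift_definition cid :: "'a::complex_normed_vector \<Rightarrow>\<^sub>C\<^sub>L 'a" is id_blinfun
  by simp

lemma apply_cid [simp]: "cblinfun_apply cid x = x"
  by transfer simp

text \<open>Completeness makes the dual space and the operator algebra Banach spaces, so that the results for dual
  pairs apply to the dual and the Hahn--Banach theorem to the operator algebra. The limit of the
  underlying real operators is again complex-linear.\<close>

instance cblinfun :: (complex_normed_vector, complex_banach) complex_banach
proof
  fix F :: "nat \<Rightarrow> 'a \<Rightarrow>\<^sub>C\<^sub>L 'b" assume F: "Cauchy F"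
  let ?G = "\<lambda>n. blinfun_of_cblinfun (F n)"
  have "Cauchy ?G" using F by (simp add: Cauchy_def dist_cblinfun.rep_eq)
  then obtain G where G: "?G \<longlonglongrightarrow> G" using Cauchy_convergent_iff convergent_def by blast
  have apply_lim: "(\<lambda>n. cblinfun_apply (F n) x) \<longlonglongrightarrow> blinfun_apply G x" for x
    using G unfolding cblinfun_apply.rep_eq by (intro tendsto_intros)
  have bl: "bounded_linear (\<lambda>y :: 'b. c *\<^sub>C y)" for c
    by (rule bounded_linear_intro[where K = "cmod c"])
      (simp_all add: scaleC_add_right scaleC_scaleR_commute norm_scaleC mult.commute)
  have "blinfun_apply G (c *\<^sub>C x) = c *\<^sub>C blinfun_apply G x" for c x
  proof (rule LIMSEQ_unique[OF apply_lim])
    have "(\<lambda>n. c *\<^sub>C cblinfun_apply (F n) x) \<longlonglongrightarrow> c *\<^sub>C blinfun_apply G x"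
      by (rule bounded_linear.tendsto[OF bl apply_lim])
    then show "(\<lambda>n. cblinfun_apply (F n) (c *\<^sub>C x)) \<longlonglongrightarrow> c *\<^sub>C blinfun_apply G x" by simp
  qed
  then have "blinfun_of_cblinfun (Cblinfun G) = G" by (simp add: Cblinfun_inverse)
  then have "F \<longlonglongrightarrow> Cblinfun G"
    using G by (simp add: LIMSEQ_def dist_cblinfun.rep_eq)
  then show "convergent F" by (auto simp: convergent_def)
qed

text \<open>The real functional \<open>L\<close> is the real part of the complex-linear \<open>x \<mapsto> L x - \<i>
  L (\<i> x)\<close>, and rotating \<open>x\<close> so that its image is real bounds the modulus by the
  real part.\<close>

theorem complex_hahn_banach:
  fixes p :: "'a::complex_normed_vector \<Rightarrow> real"
  assumes p: "sublinear p" and bound: "\<And>x. p x \<le> C * norm x"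
  obtains \<phi> :: "'a \<Rightarrow>\<^sub>C\<^sub>L complex"
  where "\<And>x. Re (cblinfun_apply \<phi> x) \<le> p x" "Re (cblinfun_apply \<phi> v) = p v" "norm \<phi> \<le> \<bar>C\<bar>"
proof -
  obtain L where L: "linear L" "\<And>x. L x \<le> p x" "L v = p v"
    using hahn_banach_sublinear[OF p, of v] by metis
  define f where "f x = Complex (L x) (- L (\<i> *\<^sub>C x))" for x
  have add: "f (x + y) = f x + f y" for x y
    by (simp add: f_def scaleC_add_right linear_add[OF L(1)] complex_eq_iff)
  have scale: "f (c *\<^sub>C x) = c *\<^sub>C f x" for c x
  proof -
    have dec: "d *\<^sub>C y = Re d *\<^sub>R y + Im d *\<^sub>R (\<i> *\<^sub>C y)" for d and y :: 'a
    proof -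
      have "d *\<^sub>C y = (complex_of_real (Re d) + complex_of_real (Im d) * \<i>) *\<^sub>C y"
        using complex_eq[of d] by (simp add: mult.commute)
      then show ?thesis by (simp add: scaleC_add_left scaleC_of_real flip: scaleC_scaleC)
    qed
    have ii: "\<i> *\<^sub>C \<i> *\<^sub>C x = - x"
      using scaleC_of_real[of "-1" x] by (simp add: scaleC_scaleC)
    have "\<i> *\<^sub>C c *\<^sub>C x = Re c *\<^sub>R (\<i> *\<^sub>C x) - Im c *\<^sub>R x"
      by (subst (2) dec) (simp add: scaleC_add_right scaleC_scaleR_commute ii)
    then show ?thesis
      by (simp add: f_def dec[of c x] linear_add[OF L(1)] linear_diff[OF L(1)] linear_scale[OF L(1)]
          scaleC_complex_def complex_eq_iff)
  qed
  have nb: "norm (f x) \<le> \<bar>C\<bar> * norm x" for x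
  proof (cases "f x = 0")
    case False
    define u where "u = cnj (f x) / cmod (f x)"
    have u: "cmod u = 1" "u * f x = cmod (f x)"
      using False complex_norm_square[of "f x"] by (simp_all add: u_def norm_divide field_simps power2_eq_square)
    have "cmod (f x) = Re (f (u *\<^sub>C x))" using u by (simp add: scale scaleC_complex_def)
    also have "\<dots> \<le> C * norm (u *\<^sub>C x)" using L(2) bound order_trans by (fastforce simp: f_def)
    also have "\<dots> \<le> \<bar>C\<bar> * norm x" using u by (simp add: norm_scaleC mult_right_mono)
    finally show ?thesis .
  qed simp
  obtain \<phi> where \<phi>: "\<And>x. cblinfun_apply \<phi> x = f x"
    using cblinfun_ex[of f, OF add scale nb] by metis
  show ?thesis
  proof (rule that[of \<phi>])
    show "norm \<phi> \<le> \<bar>C\<bar>" using nb by (intro norm_cblinfun_le) (auto simp: \<phi>)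
  qed (use L in \<open>auto simp: \<phi> f_def\<close>)
qed

lemma sublinear_norm: "sublinear norm"
  by (rule sublinearI) (auto intro: norm_triangle_ineq)

lemma norming_functional:
  fixes x :: "'a::complex_normed_vector"
  obtains \<phi> :: "'a \<Rightarrow>\<^sub>C\<^sub>L complex" where "norm \<phi> \<le> 1" "cblinfun_apply \<phi> x = norm x"
proof -
  obtain \<phi> :: "'a \<Rightarrow>\<^sub>C\<^sub>L complex" where \<phi>: "Re (cblinfun_apply \<phi> x) = norm x" "norm \<phi> \<le> 1"
    using complex_hahn_banach[OF sublinear_norm, of 1 x] by auto
  have "cmod (cblinfun_apply \<phi> x) \<le> norm x"
    using norm_apply_le[of \<phi> x] \<phi>(2) mult_right_mono[of "norm \<phi>" 1 "norm x"] by simp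
  then have "cblinfun_apply \<phi> x = norm x"
    using \<phi>(1) cmod_power2[of "cblinfun_apply \<phi> x"] power_mono[of "cmod (cblinfun_apply \<phi> x)" "norm x" 2]
    by (simp add: complex_eq_iff)
  then show ?thesis using that \<phi>(2) by blast
qed

section \<open>Dual pairs and biorthogonal sequences\<close>

text \<open>Both a reflexive space with its dual and a dual space with its predual are instances: every bounded
  functional on the second space is given by a vector of the first, and the second space norms the first
  up to the factor 2. This symmetric setting allows eigenvectors of an operator and eigenvectors of its
  adjoint to be treated by one argument.\<close>

locale cdual_pair =
  fixes pr :: "'a::complex_banach \<Rightarrow> 'b::complex_banach \<Rightarrow> complex"
  assumes add_left: "pr (x + y) b = pr x b + pr y b"
    and scale_left: "pr (c *\<^sub>C x) b = c * pr x b"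
    and add_right: "pr x (b + b') = pr x b + pr x b'"
    and scale_right: "pr x (c *\<^sub>C b) = c * pr x b"
    and bound: "cmod (pr x b) \<le> norm x * norm b"
    and norming: "\<exists>b. norm b \<le> 2 \<and> pr x b = norm x"
    and represent: "\<exists>x. \<forall>b. cblinfun_apply \<phi> b = pr x b"
begin

lemma zero_left [simp]: "pr 0 b = 0"
  using add_left[of 0 0 b] by simp

lemma zero_right [simp]: "pr x 0 = 0"
  using add_right[of x 0 0] by simp

lemma diff_left: "pr (x - y) b = pr x b - pr y b"
  using add_left[of "x - y" y b] by simp

lemma diff_right: "pr x (b - b') = pr x b - pr x b'"
  using add_right[of x "b - b'" b'] by simp

lemma sum_left: "pr (\<Sum>i\<in>I. f i) b = (\<Sum>i\<in>I. pr (f i) b)"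
  by (induction I rule: infinite_finite_induct) (auto simp: add_left)

lemma sum_right: "pr x (\<Sum>i\<in>I. f i) = (\<Sum>i\<in>I. pr x (f i))"
  by (induction I rule: infinite_finite_induct) (auto simp: add_right)

lemma bounded_linear_right: "bounded_linear (pr x)"
proof (rule bounded_linear_intro[where K = "norm x"])
  show "pr x (r *\<^sub>R b) = r *\<^sub>R pr x b" for r b
    using scale_right[of x "complex_of_real r" b] by (simp add: scaleC_of_real scaleR_conv_of_real)
  show "norm (pr x b) \<le> norm b * norm x" for b
    using bound[of x b] by (simp add: mult.commute)
qed (rule add_right)

lemma bounded_linear_left: "bounded_linear (\<lambda>x. pr x b)"
proof (rule bounded_linear_intro[where K = "norm b"])
  show "pr (r *\<^sub>R x) b = r *\<^sub>R pr x b" for r x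
    using scale_left[of "complex_of_real r" x b] by (simp add: scaleC_of_real scaleR_conv_of_real)
  show "norm (pr x b) \<le> norm x * norm b" for x
    by (rule bound)
qed (rule add_left)

lemma eq_zero_if_pr_zero:
  assumes "\<And>b. pr x b = 0"
  shows "x = 0"
  using norming[of x] assms by auto

definition biorthogonal :: "nat set \<Rightarrow> (nat \<Rightarrow> 'a) \<Rightarrow> (nat \<Rightarrow> 'b) \<Rightarrow> bool" where
  "biorthogonal I a b \<longleftrightarrow> (\<forall>i\<in>I. \<forall>j\<in>I. pr (a i) (b j) = (if i = j then 1 else 0))"

text \<open>A biorthogonal system is extended greedily. The process can only stop when no nonzero vector of
  \<open>N\<close> is annihilated by the functionals chosen so far. This replaces a distinction by
  dimension, and both alternatives come with the functionals that are needed later.\<close>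

lemma biorthogonal_dichotomy:
  assumes N: "csubspace N"
  obtains
    (infinite) a b where "\<And>k. a k \<in> N" "biorthogonal UNIV a b"
  | (finite) n a b where "\<And>i. i < n \<Longrightarrow> a i \<in> N" "biorthogonal {..<n} a b"
      "\<And>x. x \<in> N \<Longrightarrow> (\<And>i. i < n \<Longrightarrow> pr x (b i) = 0) \<Longrightarrow> x = 0"
proof -
  define P :: "(nat \<Rightarrow> 'a \<times> 'b) \<Rightarrow> nat \<Rightarrow> 'a \<times> 'b \<Rightarrow> bool" where
    "P f k r \<longleftrightarrow> fst r \<in> N \<and> pr (fst r) (snd r) = 1 \<and>
      (\<forall>i<k. pr (fst r) (snd (f i)) = 0 \<and> pr (fst (f i)) (snd r) = 0)" for f k r
  have biorth: "biorthogonal I (fst \<circ> f) (snd \<circ> f)" if "\<And>k. k \<in> I \<Longrightarrow> P f k (f k)" for f I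
    unfolding biorthogonal_def
  proof (intro ballI)
    fix i j assume "i \<in> I" "j \<in> I"
    then show "pr ((fst \<circ> f) i) ((snd \<circ> f) j) = (if i = j then 1 else 0)"
      using that[of i] that[of j] by (cases i j rule: linorder_cases) (auto simp: P_def)
  qed
  show ?thesis
  proof (cases "\<forall>k f. (\<forall>i<k. P f i (f i)) \<longrightarrow> (\<exists>r. P f k r)")
    case True
    have "\<exists>f. \<forall>k. P f k (f k)"
    proof (rule dependent_wellorder_choice)
      show "P f x r = P g x r" if "\<And>y. y < x \<Longrightarrow> f y = g y" for r f g x
        using that by (simp add: P_def)
    qed (use True in blast)
    then obtain f where f: "\<And>k. P f k (f k)" by blast
    show ?thesis
    proof (rule infinite[of "fst \<circ> f" "snd \<circ> f"])
      show "(fst \<circ> f) k \<in> N" for k using f[of k] by (simp add: P_def)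
    qed (use biorth f in blast)
  next
    case False
    then obtain n f where f: "\<And>i. i < n \<Longrightarrow> P f i (f i)" and max: "\<And>r. \<not> P f n r"
      by blast
    show ?thesis
    proof (rule finite)
      show "(fst \<circ> f) i \<in> N" if "i < n" for i using f[OF that] by (simp add: P_def)
      show bi: "biorthogonal {..<n} (fst \<circ> f) (snd \<circ> f)" using f by (intro biorth) auto
      show "x = 0" if x: "x \<in> N" "\<And>i. i < n \<Longrightarrow> pr x ((snd \<circ> f) i) = 0" for x
      proof (rule ccontr)
        assume "x \<noteq> 0"
        obtain u where u: "pr x u = norm x" using norming by blast
        \<comment> \<open>Correcting \<open>u\<close> by the earlier functionals leaves its value at \<open>x\<close> unchanged.\<close>
        define w where "w = u - (\<Sum>i<n. pr (fst (f i)) u *\<^sub>C snd (f i))"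
        have "pr x w = norm x"
          using x(2) by (simp add: w_def diff_right sum_right scale_right u)
        moreover have "pr (fst (f j)) w = 0" if "j < n" for j
        proof -
          have "(\<Sum>i<n. pr (fst (f i)) u * pr (fst (f j)) (snd (f i)))
              = (\<Sum>i<n. if i = j then pr (fst (f j)) u else 0)"
            using bi that by (intro sum.cong) (auto simp: biorthogonal_def)
          also have "\<dots> = pr (fst (f j)) u" using that by simp
          finally show ?thesis by (simp add: w_def diff_right sum_right scale_right)
        qed
        ultimately have "P f n (x, (1 / norm x) *\<^sub>C w)"
          using x \<open>x \<noteq> 0\<close> by (auto simp: P_def scale_right)
        then show False using max by blast
      qed
    qed
  qed
qed

text \<open>The vectors \<open>v i\<close> are used one after the other to make \<open>u\<close> vanish on \<open>x 0,
  x 1, \<dots>\<close>; by triangularity a later correction does not spoil an earlier one. The constant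
  depends only on the finitely many \<open>x i\<close> and \<open>v i\<close>, and the change of
  \<open>u\<close> is small on every \<open>y\<close> on which all \<open>v l\<close> are small. Therefore
  \<open>u\<close> can be chosen afterwards as a norming element of a far member of a weakly null
  sequence.\<close>

lemma triangular_elimination:
  fixes k :: nat and x :: "nat \<Rightarrow> 'a" and v :: "nat \<Rightarrow> 'b"
  assumes tri: "\<And>i j. i < k \<Longrightarrow> j < i \<Longrightarrow> pr (x j) (v i) = 0"
    and one: "\<And>i. i < k \<Longrightarrow> pr (x i) (v i) = 1"
  shows "\<exists>M\<ge>0. \<forall>u. \<exists>w. norm w \<le> M * norm u \<and> (\<forall>j<k. pr (x j) w = 0) \<and>
    (\<forall>y. cmod (pr y w - pr y u) \<le> M * norm u * (\<Sum>l<k. cmod (pr y (v l))))"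
  using assms
proof (induction k)
  case 0
  have "\<forall>u. \<exists>w :: 'b. norm w \<le> 1 * norm u \<and> (\<forall>y. cmod (pr y w - pr y u) \<le> 0)"
    by (auto intro: exI[of _ u for u])
  then show ?case by (intro exI[of _ 1]) auto
next
  case (Suc k)
  obtain M where M: "M \<ge> 0" and ex: "\<And>u. \<exists>w. norm w \<le> M * norm u \<and> (\<forall>j<k. pr (x j) w = 0) \<and>
    (\<forall>y. cmod (pr y w - pr y u) \<le> M * norm u * (\<Sum>l<k. cmod (pr y (v l))))"
    using Suc by (metis less_Suc_eq)
  define M' where "M' = M * (1 + norm (x k) * (1 + norm (v k)))"
  have M': "M' \<ge> 0" "M \<le> M'" "norm (x k) * M \<le> M'" "M + norm (x k) * M * norm (v k) \<le> M'"
    using M by (auto simp: M'_def algebra_simps)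
  have "\<exists>w. norm w \<le> M' * norm u \<and> (\<forall>j<Suc k. pr (x j) w = 0) \<and>
    (\<forall>y. cmod (pr y w - pr y u) \<le> M' * norm u * (\<Sum>l<Suc k. cmod (pr y (v l))))" for u
  proof -
    obtain w where w: "norm w \<le> M * norm u" "\<And>j. j < k \<Longrightarrow> pr (x j) w = 0"
      "\<And>y. cmod (pr y w - pr y u) \<le> M * norm u * (\<Sum>l<k. cmod (pr y (v l)))"
      using ex by metis
    define w' where "w' = w - pr (x k) w *\<^sub>C v k"
    have xw: "cmod (pr (x k) w) \<le> norm (x k) * M * norm u"
      using bound[of "x k" w] w(1) mult_left_mono[OF w(1), of "norm (x k)"] by (simp add: mult.assoc)
    have "norm w' \<le> norm w + cmod (pr (x k) w) * norm (v k)"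
      unfolding w'_def by (metis norm_triangle_ineq4 norm_scaleC)
    also have "\<dots> \<le> M * norm u + norm (x k) * M * norm u * norm (v k)"
      using w(1) xw by (intro add_mono mult_right_mono) auto
    also have "\<dots> = (M + norm (x k) * M * norm (v k)) * norm u" by (simp add: algebra_simps)
    also have "\<dots> \<le> M' * norm u" using M' by (intro mult_right_mono) auto
    finally have 1: "norm w' \<le> M' * norm u" .
    have 2: "pr (x j) w' = 0" if "j < Suc k" for j
    proof (cases "j = k")
      case True
      then show ?thesis using Suc.prems(2)[of k] by (simp add: w'_def diff_right scale_right)
    next
      case False
      then show ?thesis using that w(2)[of j] Suc.prems(1)[of k j]
        by (simp add: w'_def diff_right scale_right)
    qed
    have 3: "cmod (pr y w' - pr y u) \<le> M' * norm u * (\<Sum>l<Suc k. cmod (pr y (v l)))" for y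
    proof -
      have "pr y w' - pr y u = (pr y w - pr y u) - pr (x k) w * pr y (v k)"
        by (simp add: w'_def diff_right scale_right)
      then have "cmod (pr y w' - pr y u) \<le> cmod (pr y w - pr y u) + cmod (pr (x k) w) * cmod (pr y (v k))"
        by (metis norm_triangle_ineq4 norm_mult)
      also have "\<dots> \<le> M * norm u * (\<Sum>l<k. cmod (pr y (v l))) + norm (x k) * M * norm u * cmod (pr y (v k))"
        using w(3)[of y] xw by (intro add_mono mult_right_mono) auto
      also have "\<dots> \<le> M' * norm u * (\<Sum>l<k. cmod (pr y (v l))) + M' * norm u * cmod (pr y (v k))"
        using M' by (intro add_mono mult_right_mono) (auto intro: sum_nonneg)
      finally show ?thesis by (simp add: algebra_simps)
    qed
    show ?thesis using 1 2 3 by blast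
  qed
  then show ?case using M' by blast
qed

text \<open>Forward substitution for the coefficients of \<open>b = (\<Sum>i. \<beta> i v i)\<close>. The entries
  below the diagonal and the right-hand side are small compared with the norms of the \<open>v i\<close>,
  so the coefficients decay and the series converges with a bound on the norm of \<open>b\<close>.\<close>

lemma triangular_solve:
  fixes x :: "nat \<Rightarrow> 'a" and v :: "nat \<Rightarrow> 'b"
  assumes tri: "\<And>i j. j < i \<Longrightarrow> pr (x j) (v i) = 0"
    and one: "\<And>i. pr (x i) (v i) = 1"
    and M: "\<And>i. norm (v i) \<le> M i" "\<And>i. M i \<ge> 1"
    and small: "\<And>i j. j < i \<Longrightarrow> cmod (pr (x i) (v j)) \<le> 1 / (real (Suc i) * 2 ^ i * M i)"
    and e: "e > 0" and t: "\<And>i. cmod (t i) \<le> e / (real (Suc i) * 2 ^ i * M i)"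
  obtains b where "norm b \<le> 2 * e" "\<And>i. pr (x i) b = t i"
proof -
  have "\<exists>\<beta>. \<forall>k. \<beta> k = t k - (\<Sum>i<k. \<beta> i * pr (x k) (v i))"
    by (rule dependent_wellorder_choice[where P = "\<lambda>f k r. r = t k - (\<Sum>i<k. f i * pr (x k) (v i))"])
      auto
  then obtain \<beta> where \<beta>: "\<And>k. \<beta> k = t k - (\<Sum>i<k. \<beta> i * pr (x k) (v i))" by blast
  have \<beta>_le: "cmod (\<beta> k) \<le> e / (2 ^ k * M k)" for k
  proof (induction k rule: less_induct)
    case (less k)
    let ?h = "1 / (real (Suc k) * 2 ^ k * M k)"
    have h: "?h \<ge> 0" using M(2)[of k] by simp
    have le_e: "cmod (\<beta> i) \<le> e" if "i < k" for i
    proof -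
      have "1 \<le> 2 ^ i * M i" using M(2)[of i] by (simp add: mult_ge1_I)
      then have "e / (2 ^ i * M i) \<le> e / 1" using e by (intro divide_left_mono) auto
      then show ?thesis using less[OF that] by simp
    qed
    have "cmod (\<Sum>i<k. \<beta> i * pr (x k) (v i)) \<le> (\<Sum>i<k. e * ?h)"
    proof (rule order_trans[OF norm_sum sum_mono])
      fix i assume i: "i \<in> {..<k}"
      show "cmod (\<beta> i * pr (x k) (v i)) \<le> e * ?h"
        unfolding norm_mult using le_e[of i] small[of i k] i e by (intro mult_mono) auto
    qed
    then have "cmod (\<beta> k) \<le> e * ?h + k * (e * ?h)"
      using t[of k] norm_triangle_ineq4[of "t k" "\<Sum>i<k. \<beta> i * pr (x k) (v i)"] by (subst \<beta>) simp
    also have "\<dots> = real (Suc k) * (e * ?h)" by (simp only: of_nat_Suc distrib_right mult_1_left)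
    also have "\<dots> = e / (2 ^ k * M k)" by (simp add: mult.assoc del: of_nat_Suc)
    finally show ?case .
  qed
  have term_le: "norm (\<beta> k *\<^sub>C v k) \<le> e * (1 / 2) ^ k" for k
  proof -
    have "norm (\<beta> k *\<^sub>C v k) \<le> e / (2 ^ k * M k) * M k"
      unfolding norm_scaleC using \<beta>_le[of k] M(1)[of k] M(2)[of k] e by (intro mult_mono) auto
    also have "\<dots> = e * (1 / 2) ^ k" using M(2)[of k] by (simp add: field_simps)
    finally show ?thesis .
  qed
  have geo: "(\<lambda>k. e * (1 / 2) ^ k) sums (e * 2)"
    using geometric_sums[of "1 / 2 :: real"] by (intro sums_mult) simp
  have summ: "summable (\<lambda>k. \<beta> k *\<^sub>C v k)"
    by (rule summable_comparison_test'[OF sums_summable[OF geo], of 0]) (rule term_le)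
  define b where "b = (\<Sum>k. \<beta> k *\<^sub>C v k)"
  show ?thesis
  proof (rule that[of b])
    have "norm b \<le> (\<Sum>k. e * (1 / 2) ^ k)"
      unfolding b_def by (rule norm_suminf_le[OF term_le sums_summable[OF geo]])
    then show "norm b \<le> 2 * e" using geo by (simp add: sums_iff)
    show "pr (x i) b = t i" for i
    proof -
      have "pr (x i) b = (\<Sum>k. pr (x i) (\<beta> k *\<^sub>C v k))"
        unfolding b_def by (rule bounded_linear.suminf[OF bounded_linear_right summ])
      also have "\<dots> = (\<Sum>k<Suc i. \<beta> k * pr (x i) (v k))"
        using tri by (subst suminf_finite[where N = "{..<Suc i}"]) (auto simp: scale_right)
      also have "\<dots> = t i" using one[of i] \<beta>[of i] by simp
      finally show ?thesis .
    qed
  qed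
qed

text \<open>Only a triangular system is selected directly, with entries small enough for
  \<open>triangular_solve\<close>. Solving for \<open>c\<close> gives \<open>b0\<close>, and solving for
  multiples of the unit sequences gives the exactly biorthogonal elements. No basic sequence is involved:
  the bounds \<open>M\<close> may grow arbitrarily, because the next index is chosen after the bound is
  known.\<close>

proposition weakly_null_selection:
  fixes a :: "nat \<Rightarrow> 'a" and c :: "nat \<Rightarrow> complex"
  assumes a: "\<And>n. norm (a n) = 1" and null: "\<And>b. (\<lambda>n. pr (a n) b) \<longlonglongrightarrow> 0"
    and c: "c \<longlonglongrightarrow> 0" and e: "e > 0"
  obtains r b b0 where "biorthogonal UNIV (a \<circ> r) b" "norm b0 \<le> e"
    "\<And>k. pr (a (r k)) b0 = c (r k)"
proof -
  define \<eta> :: "nat \<Rightarrow> real \<Rightarrow> real" where "\<eta> k M = 1 / (real (Suc k) * 2 ^ k * M)" for k M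
  \<comment> \<open>The data of a step are the index \<open>n\<close>, the dual element \<open>v\<close> and the bound \<open>M\<close> for its norm.\<close>
  define P :: "(nat \<Rightarrow> nat \<times> 'b \<times> real) \<Rightarrow> nat \<Rightarrow> nat \<times> 'b \<times> real \<Rightarrow> bool" where
    "P f k s \<longleftrightarrow> (case s of (n, v, M) \<Rightarrow> norm v \<le> M \<and> M \<ge> 1 \<and> pr (a n) v = 1 \<and>
      (\<forall>j<k. pr (a (fst (f j))) v = 0) \<and> (\<forall>j<k. cmod (pr (a n) (fst (snd (f j)))) \<le> \<eta> k M) \<and>
      cmod (c n) \<le> e / 2 * \<eta> k M)" for f k s
  have "\<exists>f. \<forall>k. P f k (f k)"
  proof (rule dependent_wellorder_choice)
    show "P f k s = P g k s" if "\<And>j. j < k \<Longrightarrow> f j = g j" for s f g k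
      using that by (auto simp: P_def split: prod.splits)
    fix k f assume prev: "\<And>j. j < k \<Longrightarrow> P f j (f j)"
    define x where "x j = a (fst (f j))" for j
    define v where "v j = fst (snd (f j))" for j
    have "\<exists>M\<ge>0. \<forall>u. \<exists>w. norm w \<le> M * norm u \<and> (\<forall>j<k. pr (x j) w = 0) \<and>
      (\<forall>y. cmod (pr y w - pr y u) \<le> M * norm u * (\<Sum>l<k. cmod (pr y (v l))))"
    proof (rule triangular_elimination)
      show "pr (x j) (v i) = 0" if "i < k" "j < i" for i j
        using prev[OF that(1)] that(2) by (auto simp: P_def x_def v_def split: prod.splits)
      show "pr (x i) (v i) = 1" if "i < k" for i
        using prev[OF that(1)] by (auto simp: P_def x_def v_def split: prod.splits)
    qed
    then obtain M where M: "M \<ge> 0" and elim: "\<And>u. \<exists>w. norm w \<le> M * norm u \<and> (\<forall>j<k. pr (x j) w = 0) \<and>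
      (\<forall>y. cmod (pr y w - pr y u) \<le> M * norm u * (\<Sum>l<k. cmod (pr y (v l))))" by blast
    \<comment> \<open>The norming element has norm at most 2, and dividing by \<open>z\<close> below costs another factor 2.\<close>
    define M' where "M' = 4 * M + 1"
    have h: "\<eta> k M' > 0" using M by (simp add: \<eta>_def M'_def del: of_nat_Suc)
    have small: "eventually (\<lambda>n. \<forall>j\<in>{..<k}. cmod (pr (a n) (v j)) < \<eta> k M') sequentially"
      using null h by (intro eventually_ball_finite ballI order_tendstoD(2)[OF tendsto_norm_zero]) auto
    have "(\<lambda>n. 4 * M * (\<Sum>l<k. cmod (pr (a n) (v l)))) \<longlonglongrightarrow> 4 * M * (\<Sum>l<k. 0)"
      using null by (intro tendsto_intros tendsto_norm_zero)
    then have small2: "eventually (\<lambda>n. 4 * M * (\<Sum>l<k. cmod (pr (a n) (v l))) < 1) sequentially"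
      by (intro order_tendstoD(2)[where y = "4 * M * (\<Sum>l<k. 0)"]) auto
    have "eventually (\<lambda>n. cmod (c n) < e / 2 * \<eta> k M') sequentially"
      using c h e by (intro order_tendstoD(2)[OF tendsto_norm_zero]) auto
    with small small2 obtain n where n: "\<And>j. j < k \<Longrightarrow> cmod (pr (a n) (v j)) < \<eta> k M'"
      "4 * M * (\<Sum>l<k. cmod (pr (a n) (v l))) < 1" "cmod (c n) < e / 2 * \<eta> k M'"
      using eventually_happens[OF eventually_conj[OF small eventually_conj[OF small2 \<open>eventually (\<lambda>n. cmod (c n) < e / 2 * \<eta> k M') sequentially\<close>]]]
      by auto
    obtain u where u: "norm u \<le> 2" "pr (a n) u = 1" using norming[of "a n"] a by auto
    obtain w where w: "norm w \<le> M * norm u" "\<And>j. j < k \<Longrightarrow> pr (x j) w = 0"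
      "\<And>y. cmod (pr y w - pr y u) \<le> M * norm u * (\<Sum>l<k. cmod (pr y (v l)))"
      using elim[of u] by blast
    define z where "z = pr (a n) w"
    have "cmod (z - 1) \<le> M * norm u * (\<Sum>l<k. cmod (pr (a n) (v l)))"
      using w(3)[of "a n"] u(2) by (simp add: z_def)
    also have "\<dots> \<le> M * 2 * (\<Sum>l<k. cmod (pr (a n) (v l)))"
      using u(1) M by (intro mult_right_mono mult_left_mono sum_nonneg) auto
    also have "\<dots> \<le> 1 / 2" using n(2) by simp
    finally have z: "cmod z \<ge> 1 / 2"
      using norm_triangle_ineq2[of 1 "1 - z"] by (simp add: norm_minus_commute)
    have "norm w \<le> 2 * M" using w(1) u(1) mult_left_mono[OF u(1) M] by simp
    moreover have "1 / cmod z \<le> 2" using z by (simp add: divide_simps)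
    ultimately have "norm ((1 / z) *\<^sub>C w) \<le> M'"
      using mult_mono[of "1 / cmod z" 2 "norm w" "2 * M"] M
      by (simp add: norm_scaleC norm_divide M'_def)
    moreover have "pr (a n) ((1 / z) *\<^sub>C w) = 1" using z by (auto simp: scale_right simp flip: z_def)
    ultimately have "P f k (n, (1 / z) *\<^sub>C w, M')"
      using w(2) n M by (auto simp: P_def M'_def scale_right x_def v_def less_imp_le)
    then show "\<exists>s. P f k s" by blast
  qed
  then obtain f where f: "\<And>k. P f k (f k)" by blast
  define r where "r k = fst (f k)" for k
  define v where "v k = fst (snd (f k))" for k
  define M where "M k = snd (snd (f k))" for k
  have v: "norm (v k) \<le> M k" "M k \<ge> 1" "pr ((a \<circ> r) k) (v k) = 1"
    "\<And>j. j < k \<Longrightarrow> pr ((a \<circ> r) j) (v k) = 0"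
    "\<And>j. j < k \<Longrightarrow> cmod (pr ((a \<circ> r) k) (v j)) \<le> \<eta> k (M k)"
    "cmod (c (r k)) \<le> e / 2 * \<eta> k (M k)" for k
    using f[of k] by (auto simp: P_def r_def v_def M_def split: prod.splits)
  note solve = triangular_solve[of "a \<circ> r" v M, OF v(4) v(3) v(1) v(2) v(5)[unfolded \<eta>_def]]
  have "cmod ((c \<circ> r) i) \<le> (e / 2) / (real (Suc i) * 2 ^ i * M i)" for i
    using v(6)[of i] by (simp add: \<eta>_def del: of_nat_Suc)
  from solve[OF _ _ _ this] obtain b0 where b0: "norm b0 \<le> e" "\<And>i. pr ((a \<circ> r) i) b0 = (c \<circ> r) i"
    using e by auto
  have "\<exists>b. \<forall>i. pr ((a \<circ> r) i) b = (if i = k then 1 else 0)" for k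
  proof -
    have pos: "\<eta> i (M i) > 0" for i using v(2)[of i] by (simp add: \<eta>_def del: of_nat_Suc)
    define t where "t i = (if i = k then complex_of_real (\<eta> k (M k)) else 0)" for i
    have "cmod (t i) \<le> 1 / (real (Suc i) * 2 ^ i * M i)" for i
      using pos[of i] unfolding \<eta>_def[symmetric] by (auto simp: t_def)
    from solve[OF _ _ _ this] obtain b where "\<And>i. pr ((a \<circ> r) i) b = t i" by auto
    then show ?thesis using pos[of k]
      by (intro exI[of _ "(1 / complex_of_real (\<eta> k (M k))) *\<^sub>C b"]) (auto simp: scale_right t_def)
  qed
  then obtain b where "\<And>i k. pr ((a \<circ> r) i) (b k) = (if i = k then 1 else 0)" by metis
  then have "biorthogonal UNIV (a \<circ> r) b" by (simp add: biorthogonal_def)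
  then show ?thesis using that b0 by auto
qed

end

section \<open>Weak nullity and uniform boundedness\<close>

lemma complex_zero_if_Re_mult_le:
  assumes "\<And>c. Re (c * z) \<le> 0"
  shows "z = 0"
  using assms[of "cnj z"] by (simp add: complex_eq_iff sum_squares_le_zero_iff)

text \<open>Otherwise some subsequence has a nonzero weak limit point, and every weak limit point lies in the kernel
  of \<open>T\<close>. Compactness is replaced by the Hahn--Banach theorem: a functional dominated by
  \<open>p b = limsup Re (pr (a n) b)\<close> acts like a generalized limit, is represented by a vector
  \<open>x\<close>, and \<open>p\<close> vanishes on the range of the adjoint because \<open>T (a
  n)\<close> tends to 0, so \<open>T x = 0\<close>.\<close>

lemma (in cdual_pair) weakly_null_if_injective:
  fixes T :: "'a \<Rightarrow>\<^sub>C\<^sub>L 'a" and T' :: "'b \<Rightarrow>\<^sub>C\<^sub>L 'b"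
  assumes adj: "\<And>x b. pr (cblinfun_apply T x) b = pr x (cblinfun_apply T' b)"
    and inj: "\<And>x. cblinfun_apply T x = 0 \<Longrightarrow> x = 0"
    and a: "\<And>n. norm (a n) \<le> 1" and lim: "(\<lambda>n. cblinfun_apply T (a n)) \<longlonglongrightarrow> 0"
  shows "(\<lambda>n. pr (a n) b) \<longlonglongrightarrow> 0"
proof -
  define S where "S b = {M. eventually (\<lambda>n. Re (pr (a n) b) \<le> M) sequentially}" for b
  define p where "p b = Inf (S b)" for b
  have pr_le: "cmod (pr (a n) b) \<le> norm b" for n b
    using bound[of "a n" b] mult_right_mono[OF a[of n], of "norm b"] by simp
  have norm_in: "norm b \<in> S b" for b
    using complex_Re_le_cmod[of "pr (a n) b" for n] pr_le[of _ b]
    by (auto simp: S_def intro!: always_eventually intro: order_trans)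
  have lower: "- norm b \<le> M" if "M \<in> S b" for b M
  proof -
    have "\<exists>n. Re (pr (a n) b) \<le> M"
      using that by (auto simp: S_def eventually_sequentially)
    then obtain n where "Re (pr (a n) b) \<le> M" by blast
    then show ?thesis using abs_Re_le_cmod[of "pr (a n) b"] pr_le[of n b] by linarith
  qed
  have bdd: "bdd_below (S b)" for b using lower by (intro bdd_belowI)
  have p_le: "p b \<le> M" if "M \<in> S b" for b M
    unfolding p_def using that bdd by (rule cInf_lower)
  have p_ev: "eventually (\<lambda>n. Re (pr (a n) b) \<le> M) sequentially" if "p b < M" for b M
  proof -
    have "\<exists>M'\<in>S b. M' < M"
      using cInf_lessD[of "S b" M] that norm_in unfolding p_def by blast
    then show ?thesis unfolding S_def by (auto elim!: eventually_mono)
  qed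
  have p: "sublinear p"
  proof (rule sublinearI)
    show "p (b + c) \<le> p b + p c" for b c
    proof (rule field_le_epsilon)
      fix e :: real assume "e > 0"
      then have "eventually (\<lambda>n. Re (pr (a n) b) \<le> p b + e / 2) sequentially"
        "eventually (\<lambda>n. Re (pr (a n) c) \<le> p c + e / 2) sequentially"
        by (auto intro!: p_ev)
      then have "eventually (\<lambda>n. Re (pr (a n) (b + c)) \<le> p b + p c + e) sequentially"
        by eventually_elim (simp add: add_right)
      then show "p (b + c) \<le> p b + p c + e" by (intro p_le) (simp add: S_def)
    qed
    show "p (r *\<^sub>R b) \<le> r * p b" if r: "r > 0" for r b
    proof (rule field_le_epsilon)
      fix e :: real assume "e > 0"
      then have "eventually (\<lambda>n. Re (pr (a n) b) \<le> p b + e / r) sequentially"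
        using r by (intro p_ev) simp
      then have "eventually (\<lambda>n. Re (pr (a n) (r *\<^sub>R b)) \<le> r * p b + e) sequentially"
      proof eventually_elim
        case (elim n)
        have "Re (pr (a n) (r *\<^sub>R b)) = r * Re (pr (a n) b)"
          by (simp flip: scaleC_of_real add: scale_right)
        also have "\<dots> \<le> r * (p b + e / r)" using elim r by (intro mult_left_mono) auto
        also have "\<dots> = r * p b + e" using r by (simp add: field_simps)
        finally show ?case .
      qed
      then show "p (r *\<^sub>R b) \<le> r * p b + e" by (intro p_le) (simp add: S_def)
    qed
  qed
  have p_range: "p (cblinfun_apply T' b) \<le> 0" for b
  proof (rule field_le_epsilon)
    fix e :: real assume e: "e > 0"
    have "(\<lambda>n. pr (cblinfun_apply T (a n)) b) \<longlonglongrightarrow> pr 0 b"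
      by (rule bounded_linear.tendsto[OF bounded_linear_left lim])
    then have "(\<lambda>n. Re (pr (a n) (cblinfun_apply T' b))) \<longlonglongrightarrow> 0"
      using tendsto_Re[of "\<lambda>n. pr (a n) (cblinfun_apply T' b)" 0] by (simp add: adj)
    then have "eventually (\<lambda>n. Re (pr (a n) (cblinfun_apply T' b)) < e) sequentially"
      using e by (rule order_tendstoD)
    then have "e \<in> S (cblinfun_apply T' b)"
      unfolding S_def by (auto elim: eventually_mono)
    then show "p (cblinfun_apply T' b) \<le> 0 + e" using p_le by simp
  qed
  \<comment> \<open>Choose the generalized limit so that it attains \<open>p\<close> at \<open>b\<close>.\<close>
  have p_zero: "p b = 0" for b
  proof -
    have "p b \<le> 1 * norm b" for b using p_le[OF norm_in] by simp
    then obtain \<phi> :: "'b \<Rightarrow>\<^sub>C\<^sub>L complex"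
      where \<phi>: "\<And>b. Re (cblinfun_apply \<phi> b) \<le> p b" "Re (cblinfun_apply \<phi> b) = p b"
      using complex_hahn_banach[OF p, of 1 b] by metis
    obtain x where x: "\<And>b. cblinfun_apply \<phi> b = pr x b" using represent by blast
    have "pr (cblinfun_apply T x) b = 0" for b
    proof (rule complex_zero_if_Re_mult_le)
      show "Re (c * pr (cblinfun_apply T x) b) \<le> 0" for c
        using \<phi>(1)[of "cblinfun_apply T' (c *\<^sub>C b)"] p_range[of "c *\<^sub>C b"]
        by (simp add: adj x scale_right scaleC_complex_def)
    qed
    then have "x = 0" by (rule inj[OF eq_zero_if_pr_zero])
    then show ?thesis using \<phi>(2) x by simp
  qed
  \<comment> \<open>Applying this to the four multiples of \<open>b\<close> by 1, -1, \<open>\<i>\<close>, \<open>- \<i>\<close> controls the modulus.\<close>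
  have ev: "eventually (\<lambda>n. Re (c * pr (a n) b) \<le> e) sequentially" if "e > 0" for c e
    using p_ev[of "c *\<^sub>C b" e] that by (simp add: p_zero scale_right)
  show ?thesis
  proof (rule tendstoI)
    fix e :: real assume e: "e > 0"
    then have h: "e / 4 > 0" by simp
    show "eventually (\<lambda>n. dist (pr (a n) b) 0 < e) sequentially"
      using ev[OF h, of 1] ev[OF h, of "-1"] ev[OF h, of \<i>] ev[OF h, of "-\<i>"]
    proof eventually_elim
      case (elim n)
      then show ?case using cmod_le[of "pr (a n) b"] e by (simp add: abs_le_iff)
    qed
  qed
qed

text \<open>The uniform boundedness principle by a gliding hump. Operators with norms above \<open>4 ^ k\<close> are
  chosen, and step \<open>k\<close> moves the current point by at most \<open>3 ^ (- k)\<close> so that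
  the \<open>k\<close>-th operator becomes large there. All later steps together move the point by at most
  half of \<open>3 ^ (- k)\<close>, which cannot undo this, and \<open>(4 / 3) ^ k\<close> is unbounded.\<close>

lemma unbounded_orbit_exists:
  fixes R :: "nat \<Rightarrow> 'a::banach \<Rightarrow> 'b::real_normed_vector"
  assumes lin: "\<And>n. bounded_linear (R n)"
    and unbounded: "\<And>C. \<exists>n x. norm (R n x) > C * norm x"
  shows "\<exists>x. \<forall>C. \<exists>n. norm (R n x) > C"
proof -
  have "\<exists>n. onorm (R n) > 4 ^ k" for k :: nat
  proof -
    obtain n x where "norm (R n x) > 4 ^ k * norm x" using unbounded by blast
    then have "4 ^ k * norm x < onorm (R n) * norm x" using onorm[OF lin, of n x] by linarith
    then show ?thesis by (auto simp: mult_less_cancel_right)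
  qed
  then obtain f where f: "\<And>k. onorm (R (f k)) > 4 ^ k" by metis
  define d :: "nat \<Rightarrow> real" where "d k = (1 / 3) ^ k" for k
  have step: "\<exists>y. dist x y \<le> d k \<and> norm (R (f k) y) \<ge> 2 / 3 * d k * onorm (R (f k))" for x k
  proof -
    let ?T = "R (f k)"
    interpret bounded_linear ?T by (rule lin)
    have pos: "onorm ?T > 0" using f[of k] by (meson less_trans zero_less_numeral zero_less_power)
    have "\<exists>z. norm (?T z) > 2 / 3 * onorm ?T * norm z"
    proof (rule ccontr)
      assume "\<not> ?thesis"
      then have "onorm ?T \<le> 2 / 3 * onorm ?T"
        using pos by (intro onorm_bound) (auto simp: not_less)
      then show False using pos by simp
    qed
    then obtain z where z: "norm (?T z) > 2 / 3 * onorm ?T * norm z" by blast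
    then have "z \<noteq> 0" using zero by auto
    define y where "y = (d k / norm z) *\<^sub>R z"
    have d: "d k > 0" by (simp add: d_def)
    have y: "norm y = d k" using \<open>z \<noteq> 0\<close> d by (simp add: y_def)
    have "norm (?T y) = (d k / norm z) * norm (?T z)" using d by (simp add: y_def scaleR)
    also have "\<dots> \<ge> (d k / norm z) * (2 / 3 * onorm ?T * norm z)"
      using z d by (intro mult_left_mono) auto
    finally have Ty: "norm (?T y) \<ge> 2 / 3 * d k * onorm ?T" using \<open>z \<noteq> 0\<close> by (simp add: mult_ac)
    \<comment> \<open>One of the points \<open>x + y\<close> and \<open>x - y\<close> has an image at least as long as that of \<open>y\<close>.\<close>
    have "2 *\<^sub>R ?T y = ?T (x + y) - ?T (x - y)" by (simp add: add diff scaleR_2)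
    then have "2 * norm (?T y) \<le> norm (?T (x + y)) + norm (?T (x - y))"
      by (metis norm_scaleR norm_triangle_ineq4 abs_numeral)
    then have "norm (?T (x + y)) \<ge> norm (?T y) \<or> norm (?T (x - y)) \<ge> norm (?T y)" by linarith
    then show ?thesis
    proof
      assume "norm (?T (x + y)) \<ge> norm (?T y)"
      then show ?thesis using Ty y by (intro exI[of _ "x + y"]) (auto simp: dist_norm)
    next
      assume "norm (?T (x - y)) \<ge> norm (?T y)"
      then show ?thesis using Ty y by (intro exI[of _ "x - y"]) (auto simp: dist_norm)
    qed
  qed
  have "\<exists>x. \<forall>k. True \<and> (dist (x k) (x (Suc k)) \<le> d k \<and> norm (R (f k) (x (Suc k))) \<ge> 2 / 3 * d k * onorm (R (f k)))"
    using dependent_nat_choice[of "\<lambda>_ _. True"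
        "\<lambda>k x y. dist x y \<le> d k \<and> norm (R (f k) y) \<ge> 2 / 3 * d k * onorm (R (f k))"] step by simp
  then obtain x where x: "\<And>k. dist (x k) (x (Suc k)) \<le> d k"
    "\<And>k. norm (R (f k) (x (Suc k))) \<ge> 2 / 3 * d k * onorm (R (f k))" by blast
  have far: "dist (x m) (x (m + j)) \<le> 3 / 2 * d m - 3 / 2 * d (m + j)" for m j
  proof (induction j)
    case (Suc j)
    have "dist (x m) (x (m + Suc j)) \<le> dist (x m) (x (m + j)) + dist (x (m + j)) (x (Suc (m + j)))"
      using dist_triangle by simp
    also have "\<dots> \<le> 3 / 2 * d m - 3 / 2 * d (m + j) + d (m + j)" using Suc x(1) by (intro add_mono) auto
    finally show ?case by (simp add: d_def)
  qed simp
  have far': "dist (x m) (x n) \<le> 3 / 2 * d m" if "n \<ge> m" for m n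
  proof -
    have "d n \<ge> 0" by (simp add: d_def)
    then show ?thesis using far[of m "n - m"] that by simp
  qed
  have d0: "d \<longlonglongrightarrow> 0" unfolding d_def by (rule LIMSEQ_realpow_zero) auto
  have "Cauchy x"
  proof (rule metric_CauchyI)
    fix e :: real assume e: "e > 0"
    then obtain M where M: "d M < e / 3"
      using eventually_happens[OF order_tendstoD(2)[OF d0, of "e / 3"]] by auto
    have "dist (x m) (x n) < e" if "m \<ge> M" "n \<ge> M" for m n
      using dist_triangle3[of "x m" "x n" "x M"] far'[OF that(1)] far'[OF that(2)] M by linarith
    then show "\<exists>M. \<forall>m\<ge>M. \<forall>n\<ge>M. dist (x m) (x n) < e" by blast
  qed
  then obtain l where l: "x \<longlonglongrightarrow> l" using Cauchy_convergent_iff convergent_def by blast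
  have near: "dist (x m) l \<le> 3 / 2 * d m" for m
  proof (rule tendsto_upperbound[OF tendsto_dist[OF tendsto_const l]])
    show "eventually (\<lambda>n. dist (x m) (x n) \<le> 3 / 2 * d m) sequentially"
      using far' by (rule eventually_sequentiallyI[of m])
  qed simp
  have big: "norm (R (f k) l) \<ge> 1 / 6 * (4 / 3) ^ k" for k
  proof -
    interpret bounded_linear "R (f k)" by (rule lin)
    have "norm (R (f k) (x (Suc k) - l)) \<le> onorm (R (f k)) * norm (x (Suc k) - l)"
      by (rule onorm[OF lin])
    also have "\<dots> \<le> onorm (R (f k)) * (1 / 2 * d k)"
      using near[of "Suc k"] by (intro mult_left_mono onorm_pos_le lin) (auto simp: dist_norm d_def)
    finally have "norm (R (f k) l) \<ge> 2 / 3 * d k * onorm (R (f k)) - onorm (R (f k)) * (1 / 2 * d k)"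
      using x(2)[of k] norm_triangle_ineq2[of "R (f k) (x (Suc k))" "R (f k) l"] by (simp add: diff mult_ac)
    also have "2 / 3 * d k * onorm (R (f k)) - onorm (R (f k)) * (1 / 2 * d k) = 1 / 6 * d k * onorm (R (f k))"
      by (simp add: algebra_simps)
    also have "1 / 6 * d k * onorm (R (f k)) \<ge> 1 / 6 * d k * 4 ^ k"
      using f[of k] by (intro mult_left_mono) (auto simp: d_def)
    finally show ?thesis by (simp add: d_def power_divide)
  qed
  have "\<exists>n. norm (R n l) > C" for C
  proof -
    obtain k where "6 * C < (4 / 3) ^ k" using real_arch_pow[of "4 / 3" "6 * C"] by auto
    then show ?thesis using big[of k] by (intro exI[of _ "f k"]) linarith
  qed
  then show ?thesis by blast
qed

section \<open>Rank-one perturbations where the resolvent blows up\<close>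

definition cinverse_of :: "('a::complex_normed_vector \<Rightarrow>\<^sub>C\<^sub>L 'a) \<Rightarrow> ('a \<Rightarrow>\<^sub>C\<^sub>L 'a) \<Rightarrow> bool" where
  "cinverse_of R A \<longleftrightarrow> R o\<^sub>C A = cid \<and> A o\<^sub>C R = cid"

lemma cinverse_of_apply:
  assumes "cinverse_of R A"
  shows "cblinfun_apply R (cblinfun_apply A x) = x" "cblinfun_apply A (cblinfun_apply R x) = x"
  using assms by (metis apply_cid apply_compose cinverse_of_def)+

text \<open>The inverses of \<open>T - l n\<close> are not uniformly bounded, so they are unbounded at some
  \<open>y\<close>, and the normalized images \<open>a j\<close> of \<open>y\<close> satisfy \<open>T (a
  j) = l (s j) a j + c j y\<close> with \<open>c j\<close> tending to 0. These are approximate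
  eigenvectors for \<open>m\<close>, and as \<open>T - m\<close> is injective they are weakly null. The
  error is always a multiple of the same vector \<open>y\<close>, so one functional with prescribed values
  removes it along a subsequence.\<close>

proposition (in cdual_pair) rank_one_perturbation:
  fixes T :: "'a \<Rightarrow>\<^sub>C\<^sub>L 'a" and T' :: "'b \<Rightarrow>\<^sub>C\<^sub>L 'b" and l :: "nat \<Rightarrow> complex"
  assumes adj: "\<And>x b. pr (cblinfun_apply T x) b = pr x (cblinfun_apply T' b)"
    and l: "l \<longlonglongrightarrow> m"
    and inv: "\<And>n. \<exists>R. cinverse_of R (T - l n *\<^sub>C cid)"
    and blowup: "\<And>C. \<exists>n x. norm x > C * norm (cblinfun_apply T x - l n *\<^sub>C x)"
    and inj: "\<And>x. cblinfun_apply T x = m *\<^sub>C x \<Longrightarrow> x = 0"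
    and e: "e > 0"
  obtains y b0 a b \<mu> where "biorthogonal UNIV a b" "norm y * norm b0 < e"
    "\<And>k. cblinfun_apply T (a k) + pr (a k) b0 *\<^sub>C y = \<mu> k *\<^sub>C a k"
proof -
  obtain R where R: "\<And>n. cinverse_of (R n) (T - l n *\<^sub>C cid)" using inv by metis
  have R_eq: "cblinfun_apply T (cblinfun_apply (R n) y) = l n *\<^sub>C cblinfun_apply (R n) y + y" for n y
    using cinverse_of_apply(2)[OF R, of n y] by (simp add: diff_eq_eq add.commute)
  have "\<exists>n y. norm (cblinfun_apply (R n) y) > C * norm y" for C
  proof -
    obtain n x where "norm x > C * norm (cblinfun_apply T x - l n *\<^sub>C x)" using blowup by blast
    then show ?thesis using cinverse_of_apply(1)[OF R, of n x]
      by (intro exI[of _ n] exI[of _ "cblinfun_apply T x - l n *\<^sub>C x"]) simp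
  qed
  then obtain y where y: "\<And>C. \<exists>n. norm (cblinfun_apply (R n) y) > C"
    using unbounded_orbit_exists[of "\<lambda>n. cblinfun_apply (R n)"] bounded_linear_apply by blast
  \<comment> \<open>Large values occur at arbitrarily late indices, since finitely many operators are bounded at \<open>y\<close>.\<close>
  have "\<exists>n\<ge>j. norm (cblinfun_apply (R n) y) > real (Suc j)" for j
  proof (rule ccontr)
    assume "\<not> ?thesis"
    then have le: "norm (cblinfun_apply (R n) y) \<le> real (Suc j)" if "n \<ge> j" for n
      using that by (auto simp: not_less)
    obtain n where n: "norm (cblinfun_apply (R n) y) > real (Suc j) + (\<Sum>i<j. norm (cblinfun_apply (R i) y))"
      using y by blast
    show False
    proof (cases "n < j")
      case True
      then have "norm (cblinfun_apply (R n) y) \<le> (\<Sum>i<j. norm (cblinfun_apply (R i) y))"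
        by (intro member_le_sum) auto
      then show False using n by simp
    next
      case False
      have "(\<Sum>i<j. norm (cblinfun_apply (R i) y)) \<ge> 0" by (intro sum_nonneg) auto
      then show False using n le[of n] False by simp
    qed
  qed
  then obtain s where s: "\<And>j. s j \<ge> j" "\<And>j. norm (cblinfun_apply (R (s j)) y) > real (Suc j)"
    by metis
  define x where "x j = cblinfun_apply (R (s j)) y" for j
  define c where "c j = complex_of_real (1 / norm (x j))" for j
  define a where "a j = c j *\<^sub>C x j" for j
  have x: "norm (x j) > real (Suc j)" for j using s(2) by (simp add: x_def)
  then have xpos: "norm (x j) > 0" for j by (meson less_trans of_nat_0_less_iff zero_less_Suc)
  have a1: "norm (a j) = 1" for j using xpos[of j] by (simp add: a_def c_def norm_scaleC norm_divide)
  have Ta: "cblinfun_apply T (a j) = l (s j) *\<^sub>C a j + c j *\<^sub>C y" for j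
    by (simp add: a_def x_def R_eq scaleC_add_right complex_vector.scale_left_commute del: complex_vector.scale_scale)
  have c0: "c \<longlonglongrightarrow> 0"
  proof (rule Lim_null_comparison[OF _ LIMSEQ_inverse_real_of_nat])
    show "eventually (\<lambda>j. norm (c j) \<le> inverse (real (Suc j))) sequentially"
    proof (intro always_eventually allI)
      show "norm (c j) \<le> inverse (real (Suc j))" for j
        using le_imp_inverse_le[OF less_imp_le[OF x[of j]]]
        by (simp add: c_def norm_divide inverse_eq_divide del: of_nat_Suc)
    qed
  qed
  have "filterlim s at_top sequentially"
    using s(1) by (intro filterlim_at_top_mono[OF filterlim_ident]) auto
  then have ls: "(\<lambda>j. l (s j)) \<longlonglongrightarrow> m" using l by (rule filterlim_compose[rotated])
  have null: "(\<lambda>n. pr (a n) b) \<longlonglongrightarrow> 0" for b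
  proof (rule weakly_null_if_injective[where T = "T - m *\<^sub>C cid" and T' = "T' - m *\<^sub>C cid"])
    show "pr (cblinfun_apply (T - m *\<^sub>C cid) x) b = pr x (cblinfun_apply (T' - m *\<^sub>C cid) b)" for x b
      by (simp add: diff_left diff_right scale_left scale_right adj)
    show "x = 0" if "cblinfun_apply (T - m *\<^sub>C cid) x = 0" for x
      using that inj by simp
    show "norm (a n) \<le> 1" for n using a1 by simp
    have "(\<lambda>n. cmod (l (s n) - m) + cmod (c n) * norm y) \<longlonglongrightarrow> cmod (m - m) + cmod 0 * norm y"
      by (intro tendsto_intros ls c0)
    then have lim0: "(\<lambda>n. cmod (l (s n) - m) + cmod (c n) * norm y) \<longlonglongrightarrow> 0" by simp
    show "(\<lambda>n. cblinfun_apply (T - m *\<^sub>C cid) (a n)) \<longlonglongrightarrow> 0"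
    proof (rule Lim_null_comparison[OF always_eventually lim0], rule allI)
      fix n
      have "cblinfun_apply (T - m *\<^sub>C cid) (a n) = (l (s n) - m) *\<^sub>C a n + c n *\<^sub>C y"
        by (simp add: Ta complex_vector.scale_left_diff_distrib)
      then show "norm (cblinfun_apply (T - m *\<^sub>C cid) (a n)) \<le> cmod (l (s n) - m) + cmod (c n) * norm y"
        using norm_triangle_ineq[of "(l (s n) - m) *\<^sub>C a n" "c n *\<^sub>C y"] by (simp add: norm_scaleC a1)
    qed
  qed
  define e' where "e' = e / (2 * (norm y + 1))"
  have y1: "norm y + 1 > 0" by (simp add: add_nonneg_pos)
  moreover have "norm y < 2 * (norm y + 1)" using y1 by (simp add: distrib_left)
  ultimately have "norm y / (2 * (norm y + 1)) < 1" by simp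
  then have "e * (norm y / (2 * (norm y + 1))) < e * 1"
    using e by (rule mult_strict_left_mono)
  then have e': "e' > 0" "norm y * e' < e"
    using e y1 by (simp_all add: e'_def mult.commute)
  have "(\<lambda>n. - c n) \<longlonglongrightarrow> 0" using tendsto_minus[OF c0] by simp
  from weakly_null_selection[OF a1 null this e'(1)] obtain r b b0 where
    r: "biorthogonal UNIV (a \<circ> r) b" "norm b0 \<le> e'" "\<And>k. pr (a (r k)) b0 = - c (r k)" by metis
  show ?thesis
  proof (rule that[OF r(1)])
    show "norm y * norm b0 < e" using mult_left_mono[OF r(2), of "norm y"] e'(2) by simp
    show "cblinfun_apply T ((a \<circ> r) k) + pr ((a \<circ> r) k) b0 *\<^sub>C y = l (s (r k)) *\<^sub>C (a \<circ> r) k" for k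
      by (simp add: Ta r(3))
  qed
qed

section \<open>The spectrum\<close>

lemma cinverse_of_ex:
  fixes A :: "'a::complex_normed_vector \<Rightarrow>\<^sub>C\<^sub>L 'a"
  assumes surj: "\<And>y. \<exists>x. cblinfun_apply A x = y"
    and below: "\<And>x. norm x \<le> C * norm (cblinfun_apply A x)" and C: "C \<ge> 0"
  obtains R where "cinverse_of R A" "norm R \<le> C"
proof -
  obtain f where f: "\<And>y. cblinfun_apply A (f y) = y" using surj by metis
  have inj: "x = y" if "cblinfun_apply A x = cblinfun_apply A y" for x y
    using below[of "x - y"] that by simp
  have fA: "f (cblinfun_apply A x) = x" for x by (rule inj) (rule f)
  have le: "norm (f y) \<le> C * norm y" for y using below[of "f y"] by (simp add: f)
  obtain R where R: "\<And>y. cblinfun_apply R y = f y"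
  proof (rule cblinfun_ex[of f C])
    show "f (x + y) = f x + f y" for x y by (rule inj) (simp add: f)
    show "f (c *\<^sub>C x) = c *\<^sub>C f x" for c x by (rule inj) (simp add: f)
  qed (use le in auto)
  show ?thesis
  proof (rule that)
    show "cinverse_of R A"
      unfolding cinverse_of_def by (auto intro!: cblinfun_eqI simp: R f fA)
    show "norm R \<le> C" using le C by (intro norm_cblinfun_le) (auto simp: R)
  qed
qed

text \<open>Solving \<open>x - S x = y\<close> is finding a fixed point of the contraction \<open>x \<mapsto> y + S
  x\<close>.\<close>

lemma cinverse_of_cid_diff:
  fixes S :: "'a::complex_banach \<Rightarrow>\<^sub>C\<^sub>L 'a"
  assumes S: "norm S < 1"
  obtains R where "cinverse_of R (cid - S)" "norm R \<le> 1 / (1 - norm S)"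
proof (rule cinverse_of_ex[of "cid - S" "1 / (1 - norm S)"])
  show "\<exists>x. cblinfun_apply (cid - S) x = y" for y
  proof -
    have "\<exists>!x. y + cblinfun_apply S x = x"
    proof (rule banach_fix_type[OF norm_ge_zero S], intro allI)
      show "dist (y + cblinfun_apply S u) (y + cblinfun_apply S v) \<le> norm S * dist u v" for u v
        using norm_apply_le[of S "u - v"] by (simp add: dist_norm)
    qed
    then obtain x where x: "y + cblinfun_apply S x = x" by blast
    show ?thesis by (rule exI[of _ x]) (simp add: algebra_simps x)
  qed
  show "norm x \<le> 1 / (1 - norm S) * norm (cblinfun_apply (cid - S) x)" for x
  proof -
    have "norm x - norm S * norm x \<le> norm (cblinfun_apply (cid - S) x)"
      using norm_apply_le[of S x] norm_triangle_ineq2[of x "cblinfun_apply S x"] by simp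
    then show ?thesis using S by (simp add: field_simps)
  qed
qed (use S that in auto)

lemma cinverse_of_compose:
  assumes "cinverse_of R A" "cinverse_of Q B"
  shows "cinverse_of (Q o\<^sub>C R) (A o\<^sub>C B)"
  unfolding cinverse_of_def
  using cinverse_of_apply[OF assms(1)] cinverse_of_apply[OF assms(2)] by (auto intro!: cblinfun_eqI)

text \<open>This is the factorization \<open>A - B = A (1 - R B)\<close>.\<close>

lemma cinverse_of_diff:
  fixes A B :: "'a::complex_banach \<Rightarrow>\<^sub>C\<^sub>L 'a"
  assumes R: "cinverse_of R A" and small: "norm R * norm B < 1"
  obtains R' where "cinverse_of R' (A - B)" "norm R' \<le> norm R / (1 - norm R * norm B)"
proof -
  have le: "norm (R o\<^sub>C B) \<le> norm R * norm B" by (rule norm_compose_le)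
  then have "norm (R o\<^sub>C B) < 1" using small by linarith
  then obtain Q where Q: "cinverse_of Q (cid - R o\<^sub>C B)" "norm Q \<le> 1 / (1 - norm (R o\<^sub>C B))"
    using cinverse_of_cid_diff by metis
  have "A - B = A o\<^sub>C (cid - R o\<^sub>C B)"
    by (rule cblinfun_eqI) (simp add: cinverse_of_apply[OF R])
  then have inv: "cinverse_of (Q o\<^sub>C R) (A - B)"
    using cinverse_of_compose[OF R Q(1)] by simp
  have "norm (Q o\<^sub>C R) \<le> norm Q * norm R" by (rule norm_compose_le)
  also have "\<dots> \<le> 1 / (1 - norm R * norm B) * norm R"
    using Q(2) le small by (intro mult_right_mono order_trans[OF Q(2)] divide_left_mono) auto
  finally show ?thesis using that inv by simp
qed

lemma norm_cid_le: "norm cid \<le> 1"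
  by (rule norm_cblinfun_le) auto

lemma cinverse_of_shift:
  fixes A :: "'a::complex_banach \<Rightarrow>\<^sub>C\<^sub>L 'a"
  assumes R: "cinverse_of R (A - m *\<^sub>C cid)" and small: "norm R * cmod (n - m) \<le> 1 / 2"
  obtains R' where "cinverse_of R' (A - n *\<^sub>C cid)" "norm R' \<le> 2 * norm R"
proof -
  have le: "norm R * norm ((n - m) *\<^sub>C (cid :: 'a \<Rightarrow>\<^sub>C\<^sub>L 'a)) \<le> 1 / 2"
    using mult_left_mono[OF mult_left_mono[OF norm_cid_le[where 'a = 'a] norm_ge_zero[of "n - m"]] norm_ge_zero[of R]] small
    by (simp add: norm_scaleC)
  have eq: "A - m *\<^sub>C cid - (n - m) *\<^sub>C cid = A - n *\<^sub>C cid"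
    by (simp add: complex_vector.scale_left_diff_distrib)
  obtain R' where R': "cinverse_of R' (A - m *\<^sub>C cid - (n - m) *\<^sub>C cid)"
    "norm R' \<le> norm R / (1 - norm R * norm ((n - m) *\<^sub>C (cid :: 'a \<Rightarrow>\<^sub>C\<^sub>L 'a)))"
    using cinverse_of_diff[OF R, of "(n - m) *\<^sub>C cid"] le by auto
  note R'(2)
  also have "norm R / (1 - norm R * norm ((n - m) *\<^sub>C (cid :: 'a \<Rightarrow>\<^sub>C\<^sub>L 'a))) \<le> norm R / (1 / 2)"
    using le by (intro divide_left_mono) auto
  finally show ?thesis using that R'(1) unfolding eq by simp
qed

definition cspectrum :: "('a::complex_normed_vector \<Rightarrow>\<^sub>C\<^sub>L 'a) \<Rightarrow> complex set" where
  "cspectrum T = {m. \<nexists>R. cinverse_of R (T - m *\<^sub>C cid)}"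

lemma closed_cspectrum:
  fixes T :: "'a::complex_banach \<Rightarrow>\<^sub>C\<^sub>L 'a"
  shows "closed (cspectrum T)"
  unfolding closed_def open_dist
proof (intro ballI)
  fix m assume "m \<in> - cspectrum T"
  then obtain R where R: "cinverse_of R (T - m *\<^sub>C cid)" by (auto simp: cspectrum_def)
  have pos: "norm R + 1 > 0" by (simp add: add_nonneg_pos)
  have "n \<in> - cspectrum T" if "dist n m < 1 / (2 * (norm R + 1))" for n
  proof -
    have "norm R * cmod (n - m) \<le> (norm R + 1) * (1 / (2 * (norm R + 1)))"
      using that pos by (intro mult_mono) (auto simp: dist_norm)
    also have "\<dots> = 1 / 2" using pos by simp
    finally show ?thesis using cinverse_of_shift[OF R] by (auto simp: cspectrum_def)
  qed
  then show "\<exists>e>0. \<forall>n. dist n m < e \<longrightarrow> n \<in> - cspectrum T"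
    using pos by (intro exI[of _ "1 / (2 * (norm R + 1))"]) auto
qed

text \<open>For \<open>m\<close> beyond the norm of \<open>T\<close>, the operator \<open>T - m\<close> is a small
  perturbation of \<open>- m\<close>.\<close>

lemma cinverse_of_outside:
  fixes T :: "'a::complex_banach \<Rightarrow>\<^sub>C\<^sub>L 'a"
  assumes m: "norm T < cmod m"
  obtains R where "cinverse_of R (T - m *\<^sub>C cid)" "norm R \<le> 1 / (cmod m - norm T)"
proof -
  have m0: "cmod m > 0" using m norm_ge_zero[of T] by linarith
  let ?R = "(- (1 / m)) *\<^sub>C (cid :: 'a \<Rightarrow>\<^sub>C\<^sub>L 'a)"
  have inv: "cinverse_of ?R ((- m) *\<^sub>C cid)"
    unfolding cinverse_of_def using m0 by (auto intro!: cblinfun_eqI)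
  have nR: "norm ?R \<le> 1 / cmod m"
    using mult_left_mono[OF norm_cid_le, of "1 / cmod m"] m0 by (simp add: norm_scaleC norm_divide)
  have le: "norm ?R * norm (- T) \<le> norm T / cmod m"
    using mult_right_mono[OF nR, of "norm T"] by simp
  also have lt: "\<dots> < 1" using m m0 by simp
  finally obtain R where R: "cinverse_of R ((- m) *\<^sub>C cid - (- T))"
    "norm R \<le> norm ?R / (1 - norm ?R * norm (- T))"
    using cinverse_of_diff[OF inv] by metis
  note R(2)
  also have "norm ?R / (1 - norm ?R * norm (- T)) \<le> (1 / cmod m) / (1 - norm T / cmod m)"
    using nR le lt by (intro frac_le) auto
  also have "\<dots> = 1 / (cmod m - norm T)" using m m0 by (simp add: field_simps)
  finally show ?thesis using that R(1) by (simp add: add.commute)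
qed

section \<open>The Weyl spectrum is nonempty\<close>

definition finite_rank :: "('a::complex_normed_vector \<Rightarrow>\<^sub>C\<^sub>L 'b::complex_normed_vector) \<Rightarrow> bool" where
  "finite_rank F \<longleftrightarrow> (\<exists>W. finite W \<and> range (cblinfun_apply F) \<subseteq> cspan W)"

lemma finite_rank_zero: "finite_rank 0"
  unfolding finite_rank_def by (intro exI[of _ "{}"]) auto

lemma finite_rank_add:
  assumes "finite_rank F" "finite_rank G"
  shows "finite_rank (F + G)"
proof -
  obtain W V where W: "finite W" "range (cblinfun_apply F) \<subseteq> cspan W"
    and V: "finite V" "range (cblinfun_apply G) \<subseteq> cspan V"
    using assms by (auto simp: finite_rank_def)
  have "cspan W \<subseteq> cspan (W \<union> V)" "cspan V \<subseteq> cspan (W \<union> V)"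
    by (auto intro!: complex_vector.span_mono)
  then have "cblinfun_apply (F + G) x \<in> cspan (W \<union> V)" for x
    using W(2) V(2) unfolding apply_add by (intro complex_vector.span_add) (meson rangeI subset_iff)+
  then show ?thesis using W V unfolding finite_rank_def by blast
qed

lemma finite_rank_scaleC: "finite_rank F \<Longrightarrow> finite_rank (c *\<^sub>C F)"
  unfolding finite_rank_def by (auto intro!: complex_vector.span_scale)

lemma finite_rank_diff:
  assumes "finite_rank F" "finite_rank G"
  shows "finite_rank (F - G)"
  using finite_rank_add[OF assms(1) finite_rank_scaleC[OF assms(2), of "-1"]] by simp

lemma cspan_image:
  assumes "x \<in> cspan W"
  shows "cblinfun_apply A x \<in> cspan (cblinfun_apply A ` W)"
  using assms
proof (induction rule: complex_vector.span_induct_alt)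
  case base
  then show ?case by (simp add: complex_vector.span_zero)
next
  case (step c x y)
  then show ?case
    by (simp add: complex_vector.span_add complex_vector.span_scale complex_vector.span_base)
qed

lemma finite_rank_compose:
  assumes "finite_rank F"
  shows "finite_rank (A o\<^sub>C F o\<^sub>C B)"
proof -
  obtain W where W: "finite W" "range (cblinfun_apply F) \<subseteq> cspan W"
    using assms by (auto simp: finite_rank_def)
  then have "range (cblinfun_apply (A o\<^sub>C F o\<^sub>C B)) \<subseteq> cspan (cblinfun_apply A ` W)"
    by (auto intro!: cspan_image)
  then show ?thesis using W unfolding finite_rank_def by blast
qed

text \<open>An operator at distance less than 1 from the identity is onto.\<close>

lemma cid_far_from_finite_rank:
  fixes F :: "'a::complex_banach \<Rightarrow>\<^sub>C\<^sub>L 'a"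
  assumes inf: "\<not> finite_cdim (UNIV :: 'a set)" and F: "finite_rank F"
  shows "1 \<le> norm (cid - F)"
proof (rule ccontr)
  assume "\<not> ?thesis"
  then obtain R where R: "cinverse_of R (cid - (cid - F))"
    using cinverse_of_cid_diff[of "cid - F"] by (metis not_le)
  then have "cblinfun_apply F (cblinfun_apply R y) = y" for y
    using cinverse_of_apply(2)[OF R, of y] by simp
  then have surj: "range (cblinfun_apply F) = UNIV" by (metis surjI)
  then have "\<exists>W. finite W \<and> (UNIV :: 'a set) \<subseteq> cspan W" using F by (simp add: finite_rank_def)
  then have "\<exists>W. finite W \<and> W \<subseteq> UNIV \<and> cspan W = (UNIV :: 'a set)" by auto
  then show False using inf by (simp add: finite_cdim_def)
qed

text \<open>The Hahn--Banach theorem is applied to the distance from the finite-rank operators. The functional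
  obtained does not distinguish inverses of operators that differ by an operator of finite rank.\<close>

lemma finite_rank_annihilator:
  assumes inf: "\<not> finite_cdim (UNIV :: 'a::complex_banach set)"
  obtains \<phi> :: "('a::complex_banach \<Rightarrow>\<^sub>C\<^sub>L 'a) \<Rightarrow>\<^sub>C\<^sub>L complex"
  where "\<And>F. finite_rank F \<Longrightarrow> cblinfun_apply \<phi> F = 0" "Re (cblinfun_apply \<phi> cid) \<ge> 1" "norm \<phi> \<le> 1"
proof -
  define S where "S A = (\<lambda>F. norm (A - F)) ` {F :: 'a \<Rightarrow>\<^sub>C\<^sub>L 'a. finite_rank F}" for A
  define p where "p A = Inf (S A)" for A
  have ne: "S A \<noteq> {}" for A using finite_rank_zero by (auto simp: S_def)
  have bdd: "bdd_below (S A)" for A by (intro bdd_belowI[of _ 0]) (auto simp: S_def)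
  have p_le: "p A \<le> norm (A - F)" if "finite_rank F" for A F
    unfolding p_def using that bdd by (intro cInf_lower) (auto simp: S_def)
  have p_near: "\<exists>F. finite_rank F \<and> norm (A - F) < p A + e" if "e > 0" for A e
  proof -
    have "\<exists>s\<in>S A. s < p A + e"
      using cInf_lessD[OF ne, of A "p A + e"] that unfolding p_def by auto
    then show ?thesis by (auto simp: S_def)
  qed
  have p: "sublinear p"
  proof (rule sublinearI)
    show "p (A + B) \<le> p A + p B" for A B
    proof (rule field_le_epsilon)
      fix e :: real assume "e > 0"
      then obtain F G where F: "finite_rank F" "norm (A - F) < p A + e / 2"
        and G: "finite_rank G" "norm (B - G) < p B + e / 2"
        using p_near[of "e / 2"] by (metis half_gt_zero)
      have "p (A + B) \<le> norm (A + B - (F + G))" by (intro p_le finite_rank_add F G)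
      also have "\<dots> \<le> norm (A - F) + norm (B - G)" by (rule norm_diff_triangle_ineq)
      finally show "p (A + B) \<le> p A + p B + e" using F G by simp
    qed
    show "p (r *\<^sub>R A) \<le> r * p A" if r: "r > 0" for r A
    proof (rule field_le_epsilon)
      fix e :: real assume "e > 0"
      then obtain F where F: "finite_rank F" "norm (A - F) < p A + e / r"
        using p_near[of "e / r"] r by (metis divide_pos_pos)
      have "finite_rank (r *\<^sub>R F)"
        using finite_rank_scaleC[OF F(1), of "complex_of_real r"] by (simp only: scaleC_of_real)
      then have "p (r *\<^sub>R A) \<le> norm (r *\<^sub>R A - r *\<^sub>R F)" by (rule p_le)
      also have "\<dots> = r * norm (A - F)" using r by (simp flip: scaleR_diff_right)
      also have "\<dots> \<le> r * (p A + e / r)" using F r by (intro mult_left_mono) auto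
      also have "\<dots> = r * p A + e" using r by (simp add: field_simps)
      finally show "p (r *\<^sub>R A) \<le> r * p A + e" .
    qed
  qed
  have "p A \<le> 1 * norm A" for A using p_le[OF finite_rank_zero, of A] by simp
  then obtain \<phi> :: "('a \<Rightarrow>\<^sub>C\<^sub>L 'a) \<Rightarrow>\<^sub>C\<^sub>L complex" where \<phi>: "\<And>A. Re (cblinfun_apply \<phi> A) \<le> p A"
    "Re (cblinfun_apply \<phi> cid) = p cid" "norm \<phi> \<le> \<bar>1\<bar>"
    using complex_hahn_banach[OF p, of 1 cid] by metis
  show ?thesis
  proof (rule that)
    show "cblinfun_apply \<phi> F = 0" if F: "finite_rank F" for F
    proof (rule complex_zero_if_Re_mult_le)
      show "Re (c * cblinfun_apply \<phi> F) \<le> 0" for c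
        using \<phi>(1)[of "c *\<^sub>C F"] p_le[OF finite_rank_scaleC[OF F, of c], of "c *\<^sub>C F"]
        by (simp add: scaleC_complex_def)
    qed
    have "1 \<le> p cid"
      unfolding p_def using cid_far_from_finite_rank[OF inf] ne by (intro cInf_greatest) (auto simp: S_def)
    then show "Re (cblinfun_apply \<phi> cid) \<ge> 1" using \<phi>(2) by simp
    show "norm \<phi> \<le> 1" using \<phi>(3) by simp
  qed
qed

text \<open>Suppose that every \<open>T - m\<close> becomes invertible after adding some \<open>F m\<close> of finite
  rank. Different corrections give inverses with a finite-rank difference, so the value \<open>g m\<close>
  of \<open>\<phi>\<close> at the inverse depends on \<open>m\<close> only. Near a given point one fixed
  correction serves all parameters, so \<open>g\<close> is differentiable by the resolvent identity. For
  large \<open>m\<close> no correction is necessary and \<open>g\<close> tends to 0, so \<open>g =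
  0\<close> by Liouville. But \<open>\<phi>\<close> applied to \<open>(T - m) Q = 1\<close>, with
  \<open>Q\<close> the inverse, shows that \<open>m g m\<close> is bounded away from 0 for large
  \<open>m\<close>.\<close>

theorem weyl_spectrum_nonempty:
  fixes T :: "'a::complex_banach \<Rightarrow>\<^sub>C\<^sub>L 'a"
  assumes inf: "\<not> finite_cdim (UNIV :: 'a set)"
  shows "\<exists>m. \<forall>F. finite_rank F \<longrightarrow> m \<in> cspectrum (T + F)"
proof (rule ccontr)
  assume "\<not> ?thesis"
  then have "\<forall>m. \<exists>F R. finite_rank F \<and> cinverse_of R (T + F - m *\<^sub>C cid)"
    by (simp add: cspectrum_def)
  then obtain F R where F: "\<And>m. finite_rank (F m)" and R: "\<And>m. cinverse_of (R m) (T + F m - m *\<^sub>C cid)"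
    by metis
  obtain \<phi> :: "('a \<Rightarrow>\<^sub>C\<^sub>L 'a) \<Rightarrow>\<^sub>C\<^sub>L complex" where
    \<phi>: "\<And>F. finite_rank F \<Longrightarrow> cblinfun_apply \<phi> F = 0" "Re (cblinfun_apply \<phi> cid) \<ge> 1" "norm \<phi> \<le> 1"
    using finite_rank_annihilator[OF inf] by metis
  have \<phi>_le: "cmod (cblinfun_apply \<phi> A) \<le> norm A" for A
    using norm_apply_le[of \<phi> A] mult_right_mono[OF \<phi>(3), of "norm A"] by simp
  define g where "g m = cblinfun_apply \<phi> (R m)" for m
  have g_eq: "g m = cblinfun_apply \<phi> Q" if G: "finite_rank G" and Q: "cinverse_of Q (T + G - m *\<^sub>C cid)" for m G Q
  proof -
    \<comment> \<open>Second resolvent identity.\<close>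
    have "R m - Q = R m o\<^sub>C (G - F m) o\<^sub>C Q"
    proof (rule cblinfun_eqI)
      fix y
      have "cblinfun_apply (G - F m) (cblinfun_apply Q y)
          = cblinfun_apply (T + G - m *\<^sub>C cid) (cblinfun_apply Q y)
            - cblinfun_apply (T + F m - m *\<^sub>C cid) (cblinfun_apply Q y)" by simp
      then show "cblinfun_apply (R m - Q) y = cblinfun_apply (R m o\<^sub>C (G - F m) o\<^sub>C Q) y"
        using cinverse_of_apply[OF R, of m] cinverse_of_apply[OF Q]
        by (simp only: apply_diff apply_compose apply_simps)
    qed
    then have "cblinfun_apply \<phi> (R m - Q) = 0"
      by (simp only: \<phi>(1)[OF finite_rank_compose[OF finite_rank_diff[OF G F]]])
    then show ?thesis by (simp add: g_def)
  qed
  have deriv: "\<exists>D. (g has_field_derivative D) (at m)" for m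
  proof -
    let ?K = "2 * norm (R m) * norm (R m) * norm (R m)"
    have quot: "cmod ((g n - g m) / (n - m) - cblinfun_apply \<phi> (R m o\<^sub>C R m)) \<le> ?K * cmod (n - m)"
      if n: "n \<noteq> m" "norm (R m) * cmod (n - m) \<le> 1 / 2" for n
    proof -
      obtain Q where Q: "cinverse_of Q (T + F m - n *\<^sub>C cid)" "norm Q \<le> 2 * norm (R m)"
        using cinverse_of_shift[OF R n(2)] by metis
      \<comment> \<open>First resolvent identity.\<close>
      have diff: "Q - R m = (n - m) *\<^sub>C (Q o\<^sub>C R m)"
      proof (rule cblinfun_eqI)
        fix y
        have "(n - m) *\<^sub>C cblinfun_apply (R m) y
          = cblinfun_apply (T + F m - m *\<^sub>C cid) (cblinfun_apply (R m) y)
            - cblinfun_apply (T + F m - n *\<^sub>C cid) (cblinfun_apply (R m) y)"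
          by (simp add: complex_vector.scale_left_diff_distrib)
        then have "cblinfun_apply Q ((n - m) *\<^sub>C cblinfun_apply (R m) y) = cblinfun_apply (Q - R m) y"
          using cinverse_of_apply[OF R, of m] cinverse_of_apply[OF Q(1)]
          by (simp only: apply_diff apply_simps)
        then show "cblinfun_apply (Q - R m) y = cblinfun_apply ((n - m) *\<^sub>C (Q o\<^sub>C R m)) y" by simp
      qed
      have "g n - g m = cblinfun_apply \<phi> (Q - R m)"
        using g_eq[OF F Q(1)] by (simp add: g_def)
      then have "(g n - g m) / (n - m) = cblinfun_apply \<phi> (Q o\<^sub>C R m)"
        using n(1) by (simp add: diff scaleC_complex_def)
      moreover have "Q o\<^sub>C R m - R m o\<^sub>C R m = (Q - R m) o\<^sub>C R m"
        by (rule cblinfun_eqI) simp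
      ultimately have "cmod ((g n - g m) / (n - m) - cblinfun_apply \<phi> (R m o\<^sub>C R m)) \<le> norm ((Q - R m) o\<^sub>C R m)"
        using \<phi>_le[of "(Q - R m) o\<^sub>C R m"] by (metis apply_simps(2))
      also have "\<dots> \<le> norm (Q - R m) * norm (R m)" by (rule norm_compose_le)
      also have "\<dots> \<le> (cmod (n - m) * (2 * norm (R m) * norm (R m))) * norm (R m)"
        unfolding diff norm_scaleC
        by (intro mult_right_mono mult_left_mono order_trans[OF norm_compose_le] Q(2)) auto
      finally show ?thesis by (simp add: mult_ac)
    qed
    have "((\<lambda>n. (g n - g m) / (n - m) - cblinfun_apply \<phi> (R m o\<^sub>C R m)) \<longlongrightarrow> 0) (at m)"
    proof (rule Lim_null_comparison)
      have "((\<lambda>n. norm (R m) * cmod (n - m)) \<longlongrightarrow> norm (R m) * cmod (m - m)) (at m)"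
        by (intro tendsto_intros)
      then have "eventually (\<lambda>n. norm (R m) * cmod (n - m) < 1 / 2) (at m)"
        by (rule order_tendstoD) simp
      then show "eventually (\<lambda>n. cmod ((g n - g m) / (n - m) - cblinfun_apply \<phi> (R m o\<^sub>C R m)) \<le> ?K * cmod (n - m)) (at m)"
        using eventually_neq_at_within[of m m UNIV] by eventually_elim (rule quot, auto)
      have "((\<lambda>n. ?K * cmod (n - m)) \<longlongrightarrow> ?K * cmod (m - m)) (at m)"
        by (intro tendsto_intros)
      then show "((\<lambda>n. ?K * cmod (n - m)) \<longlongrightarrow> 0) (at m)" by simp
    qed
    then have "((\<lambda>n. (g n - g m) / (n - m)) \<longlongrightarrow> cblinfun_apply \<phi> (R m o\<^sub>C R m)) (at m)"
      by (rule LIM_zero_cancel)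
    then show ?thesis unfolding has_field_derivative_iff by (rule exI)
  qed
  have far: "\<exists>Q. g m = cblinfun_apply \<phi> Q \<and> cinverse_of Q (T - m *\<^sub>C cid) \<and> norm Q \<le> 1 / (cmod m - norm T)"
    if m: "norm T < cmod m" for m
  proof -
    obtain Q where Q: "cinverse_of Q (T - m *\<^sub>C cid)" "norm Q \<le> 1 / (cmod m - norm T)"
      using cinverse_of_outside[OF m] by metis
    then show ?thesis using g_eq[OF finite_rank_zero, of Q m] by auto
  qed
  have "(g \<longlongrightarrow> 0) at_infinity"
    unfolding tendsto_iff eventually_at_infinity
  proof (intro allI impI)
    fix e :: real assume e: "e > 0"
    have "dist (g m) 0 < e" if m: "norm T + 2 / e \<le> cmod m" for m
    proof -
      have "2 / e > 0" using e by simp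
      then have lt: "norm T < cmod m" "2 / e \<le> cmod m - norm T" using m by linarith+
      obtain Q where Q: "g m = cblinfun_apply \<phi> Q" "norm Q \<le> 1 / (cmod m - norm T)"
        using far[OF lt(1)] by blast
      have "1 / (cmod m - norm T) \<le> 1 / (2 / e)" using lt e by (intro divide_left_mono) auto
      then have "cmod (g m) \<le> e / 2" using Q \<phi>_le[of Q] by simp
      then show ?thesis using e by simp
    qed
    then show "\<exists>b. \<forall>m. b \<le> norm m \<longrightarrow> dist (g m) 0 < e" by blast
  qed
  moreover have "g holomorphic_on UNIV"
    using deriv by (auto simp: holomorphic_on_open)
  ultimately have g0: "g m = 0" for m by (rule Liouville_weak_0[rotated])
  \<comment> \<open>At this point the inverse has norm at most \<open>1 / (norm T + 1)\<close>, so \<open>T Q\<close> has norm less than 1.\<close>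
  define m where "m = complex_of_real (2 * norm T + 1)"
  have cm: "cmod m = 2 * norm T + 1" unfolding m_def norm_of_real by simp
  then have "norm T < cmod m" using norm_ge_zero[of T] by linarith
  then obtain Q where Q: "g m = cblinfun_apply \<phi> Q" "cinverse_of Q (T - m *\<^sub>C cid)"
    "norm Q \<le> 1 / (cmod m - norm T)" using far by blast
  have "T o\<^sub>C Q - m *\<^sub>C Q = cid"
    using cinverse_of_apply(2)[OF Q(2)] by (intro cblinfun_eqI) simp
  then have "cblinfun_apply \<phi> cid = cblinfun_apply \<phi> (T o\<^sub>C Q) - m *\<^sub>C cblinfun_apply \<phi> Q"
    by (metis apply_simps(2) apply_scaleC)
  then have "1 \<le> Re (cblinfun_apply \<phi> (T o\<^sub>C Q))"
    using \<phi>(2) g0[of m] Q(1) by simp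
  also have "\<dots> \<le> norm T * norm Q"
    by (rule order_trans[OF complex_Re_le_cmod order_trans[OF \<phi>_le norm_compose_le]])
  also have "\<dots> \<le> norm T * (1 / (norm T + 1))"
    using Q(3) by (intro mult_left_mono) (auto simp: cm)
  also have "\<dots> < 1" using norm_ge_zero[of T] by (simp add: add_nonneg_pos)
  finally show False by simp
qed

section \<open>The two dual pairs of a reflexive space\<close>

lemma cdual_pair_functionals:
  "cdual_pair (\<lambda>(f :: 'a::complex_banach \<Rightarrow>\<^sub>C\<^sub>L complex) x. cblinfun_apply f x)"
proof
  show "\<exists>b. norm b \<le> 2 \<and> cblinfun_apply f b = complex_of_real (norm f)" for f :: "'a \<Rightarrow>\<^sub>C\<^sub>L complex"
  proof (cases "f = 0")
    case True
    then show ?thesis by (intro exI[of _ 0]) simp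
  next
    case False
    \<comment> \<open>The norm of \<open>f\<close> need not be attained, which is the reason for the factor 2 in the norming axiom.\<close>
    have "\<exists>x. cmod (cblinfun_apply f x) > norm f / 2 * norm x"
    proof (rule ccontr)
      assume "\<not> ?thesis"
      then have "norm f \<le> norm f / 2"
        by (intro norm_cblinfun_le) (auto simp: not_less)
      then show False using False by simp
    qed
    then obtain x where x: "cmod (cblinfun_apply f x) > norm f / 2 * norm x" by blast
    let ?b = "(norm f / cblinfun_apply f x) *\<^sub>C x"
    have pos: "cmod (cblinfun_apply f x) > 0"
      using x by (rule order.strict_trans1[rotated]) simp
    have "norm ?b = norm f * norm x / cmod (cblinfun_apply f x)"
      by (simp add: norm_scaleC norm_divide)
    also have "\<dots> \<le> 2" using x pos by (simp add: pos_divide_le_eq)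
    finally have "norm ?b \<le> 2" .
    moreover have "cblinfun_apply f ?b = complex_of_real (norm f)"
      using pos by (simp add: scaleC_complex_def)
    ultimately show ?thesis by blast
  qed
qed (auto simp: scaleC_complex_def norm_apply_le)

lemma cdual_pair_reflexive:
  assumes "reflexive TYPE('a::complex_banach)"
  shows "cdual_pair (\<lambda>(x :: 'a) f. cblinfun_apply f x)"
proof
  show "\<exists>f. norm f \<le> 2 \<and> cblinfun_apply f x = complex_of_real (norm x)" for x :: 'a
  proof -
    obtain f :: "'a \<Rightarrow>\<^sub>C\<^sub>L complex" where "norm f \<le> 1" "cblinfun_apply f x = norm x"
      using norming_functional by blast
    then show ?thesis by (intro exI[of _ f]) simp
  qed
  show "\<exists>x. \<forall>f. cblinfun_apply \<phi> f = cblinfun_apply f x" for \<phi> :: "('a \<Rightarrow>\<^sub>C\<^sub>L complex) \<Rightarrow>\<^sub>C\<^sub>L complex"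
  proof -
    have "surj (bidual_embedding :: 'a \<Rightarrow> _)" using assms by (simp add: reflexive_def)
    then obtain x where "\<phi> = bidual_embedding x" by (rule surjE)
    then show ?thesis by (auto simp: bidual_embedding_apply)
  qed
  show "cmod (cblinfun_apply f x) \<le> norm x * norm f" for f :: "'a \<Rightarrow>\<^sub>C\<^sub>L complex" and x
    using norm_apply_le[of f x] by (simp add: mult.commute)
qed (auto simp: scaleC_complex_def)

definition cadjoint ::
  "('a::complex_normed_vector \<Rightarrow>\<^sub>C\<^sub>L 'a) \<Rightarrow> (('a \<Rightarrow>\<^sub>C\<^sub>L complex) \<Rightarrow>\<^sub>C\<^sub>L ('a \<Rightarrow>\<^sub>C\<^sub>L complex))" where
  "cadjoint T = (SOME T'. \<forall>f. cblinfun_apply T' f = f o\<^sub>C T)"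

lemma cadjoint_apply [simp]: "cblinfun_apply (cadjoint T) f = f o\<^sub>C T"
proof -
  obtain T' :: "('a \<Rightarrow>\<^sub>C\<^sub>L complex) \<Rightarrow>\<^sub>C\<^sub>L ('a \<Rightarrow>\<^sub>C\<^sub>L complex)"
    where "\<And>f. cblinfun_apply T' f = f o\<^sub>C T"
  proof (rule cblinfun_ex[of "\<lambda>f :: 'a \<Rightarrow>\<^sub>C\<^sub>L complex. f o\<^sub>C T" "norm T"])
    show "norm (f o\<^sub>C T) \<le> norm T * norm f" for f :: "'a \<Rightarrow>\<^sub>C\<^sub>L complex"
      using norm_compose_le[of f T] by (simp add: mult.commute)
  qed (auto intro!: cblinfun_eqI)
  then have "\<exists>T' :: ('a \<Rightarrow>\<^sub>C\<^sub>L complex) \<Rightarrow>\<^sub>C\<^sub>L ('a \<Rightarrow>\<^sub>C\<^sub>L complex). \<forall>f. cblinfun_apply T' f = f o\<^sub>C T" by blast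
  then have "\<forall>f. cblinfun_apply (cadjoint T) f = f o\<^sub>C T" unfolding cadjoint_def by (rule someI_ex)
  then show ?thesis by blast
qed

section \<open>Linear independence and halfspaces\<close>

definition seq_independent :: "(nat \<Rightarrow> 'a::complex_vector) \<Rightarrow> bool" where
  "seq_independent z \<longleftrightarrow>
    (\<forall>I c. finite I \<longrightarrow> (\<Sum>i\<in>I. c i *\<^sub>C z i) = 0 \<longrightarrow> (\<forall>i\<in>I. c i = 0))"

lemma seq_independent_not_in_finite_span:
  assumes z: "seq_independent z" and B: "finite B"
  shows "\<exists>k. z k \<notin> cspan B"
proof (rule ccontr)
  assume "\<not> ?thesis"
  then have sub: "range z \<subseteq> cspan B" by blast
  have inj: "inj z"
  proof (rule injI, rule ccontr)
    fix i j assume eq: "z i = z j" and ne: "i \<noteq> j"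
    let ?c = "\<lambda>k. if k = i then 1 else (-1 :: complex)"
    have "(\<Sum>k\<in>{i, j}. ?c k *\<^sub>C z k) = 0" using eq ne by simp
    then show False using z[unfolded seq_independent_def, rule_format, of "{i, j}" ?c i] by simp
  qed
  have "\<not> complex_vector.dependent (range z)"
    unfolding complex_vector.dependent_explicit
  proof (safe)
    fix t u x
    assume t: "finite t" "t \<subseteq> range z" "(\<Sum>v\<in>t. u v *\<^sub>C v) = 0" and x: "x \<in> t" "u x \<noteq> 0"
    define I where "I = z -` t"
    have tI: "t = z ` I" using t(2) by (auto simp: I_def)
    have "finite I" unfolding I_def using t(1) inj by (rule finite_vimageI)
    moreover have "(\<Sum>i\<in>I. u (z i) *\<^sub>C z i) = 0"
      using t(3) inj unfolding tI by (simp add: sum.reindex inj_on_def)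
    ultimately have "\<forall>i\<in>I. u (z i) = 0"
      using z[unfolded seq_independent_def, rule_format, of I "\<lambda>i. u (z i)"] by blast
    then show False using x tI by auto
  qed
  then have "finite (range z)"
    using complex_vector.independent_span_bound[OF B _ sub] by blast
  then show False using range_inj_infinite[OF inj] by blast
qed

lemma seq_independent_if_biorthogonal:
  fixes z :: "nat \<Rightarrow> 'a::complex_normed_vector"
  assumes "\<And>i j. cblinfun_apply (f i) (z j) = (if i = j then 1 else (0 :: complex))"
  shows "seq_independent z"
  unfolding seq_independent_def
proof (intro allI impI ballI)
  fix I :: "nat set" and c i assume I: "finite I" "(\<Sum>j\<in>I. c j *\<^sub>C z j) = 0" "i \<in> I"
  have "0 = cblinfun_apply (f i) (\<Sum>j\<in>I. c j *\<^sub>C z j)" using I(2) by simp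
  also have "\<dots> = (\<Sum>j\<in>I. if j = i then c j else 0)"
    using assms by (auto simp: apply_sum scaleC_complex_def intro!: sum.cong)
  also have "\<dots> = c i" using I by simp
  finally show "c i = 0" by simp
qed

text \<open>Applying \<open>T - \<mu> j\<close> to a vanishing combination removes the \<open>j\<close>-th term and
  multiplies the other coefficients by the nonzero numbers \<open>\<mu> i - \<mu> j\<close>.\<close>

lemma seq_independent_eigenvectors:
  assumes T: "\<And>i. cblinfun_apply T (u i) = \<mu> i *\<^sub>C u i" and u: "\<And>i. u i \<noteq> 0" and \<mu>: "inj \<mu>"
  shows "seq_independent u"
  unfolding seq_independent_def
proof (intro allI impI)
  fix I :: "nat set" and c :: "nat \<Rightarrow> complex" assume "finite I" "(\<Sum>i\<in>I. c i *\<^sub>C u i) = 0"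
  then show "\<forall>i\<in>I. c i = 0"
  proof (induction I arbitrary: c)
    case (insert j I)
    have s: "(\<Sum>i\<in>I. c i *\<^sub>C u i) = - (c j *\<^sub>C u j)"
      using insert by (simp add: eq_neg_iff_add_eq_0 add.commute)
    have "cblinfun_apply T (\<Sum>i\<in>I. c i *\<^sub>C u i) - \<mu> j *\<^sub>C (\<Sum>i\<in>I. c i *\<^sub>C u i) = 0"
      unfolding s by (simp add: T mult.commute)
    then have "(\<Sum>i\<in>I. (c i * (\<mu> i - \<mu> j)) *\<^sub>C u i) = 0"
      by (simp add: apply_sum T complex_vector.scale_sum_right sum_subtractf[symmetric]
          complex_vector.scale_left_diff_distrib right_diff_distrib mult.commute)
    then have "\<forall>i\<in>I. c i * (\<mu> i - \<mu> j) = 0" by (rule insert.IH)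
    moreover have "\<mu> i \<noteq> \<mu> j" if "i \<in> I" for i
      using that insert.hyps \<mu> by (auto simp: inj_def)
    ultimately have c: "\<forall>i\<in>I. c i = 0" by auto
    then have "c j *\<^sub>C u j = 0" using s by simp
    then show ?case using c u[of j] by simp
  qed simp
qed

text \<open>In the finite alternative of \<open>biorthogonal_dichotomy\<close> every \<open>x\<close> in
  \<open>N\<close> equals \<open>(\<Sum>i<n. pr x (b i) a i)\<close>, so \<open>N\<close> would have
  finite dimension.\<close>

lemma (in cdual_pair) biorthogonal_in_subspace:
  assumes N: "csubspace N" and z: "\<And>k. z k \<in> N" "seq_independent z"
  obtains a b where "\<And>k. a k \<in> N" "biorthogonal UNIV a b"
  using N
proof (cases rule: biorthogonal_dichotomy)
  case (finite n a b)
  have span: "x \<in> cspan (a ` {..<n})" if "x \<in> N" for x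
  proof -
    let ?y = "\<Sum>i<n. pr x (b i) *\<^sub>C a i"
    have y: "?y \<in> cspan (a ` {..<n})"
      by (intro complex_vector.span_sum complex_vector.span_scale complex_vector.span_base) auto
    have "cspan (a ` {..<n}) \<subseteq> N"
      using finite(1) N by (intro complex_vector.span_minimal) auto
    then have mem: "x - ?y \<in> N" using that y N by (auto intro: complex_vector.subspace_diff)
    have "pr (x - ?y) (b j) = 0" if "j < n" for j
    proof -
      have "pr (a i) (b j) = (if i = j then 1 else 0)" if "i < n" for i
        using finite(2) that \<open>j < n\<close> by (auto simp: biorthogonal_def)
      then have "pr ?y (b j) = (\<Sum>i<n. if i = j then pr x (b i) else 0)"
        unfolding sum_left scale_left by (intro sum.cong) auto
      then show ?thesis using that by (simp add: diff_left)
    qed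
    then have "x - ?y = 0" by (rule finite(3)[OF mem])
    then show ?thesis using y by simp
  qed
  then show ?thesis
    using seq_independent_not_in_finite_span[OF z(2), of "a ` {..<n}"] z(1) by blast
qed (use that in blast)

text \<open>The functionals \<open>g k\<close> vanish on \<open>Y\<close>, so their biorthogonality to
  \<open>z\<close> is inherited by representatives of the cosets of \<open>z k\<close>. If finitely many
  cosets spanned the quotient, these representatives could be taken in a space of finite dimension.\<close>

lemma halfspaceI:
  fixes Y :: "'a::complex_normed_vector set" and x z :: "nat \<Rightarrow> 'a"
    and f g :: "nat \<Rightarrow> 'a \<Rightarrow>\<^sub>C\<^sub>L complex"
  assumes Y: "csubspace Y" "closed Y"
    and x: "\<And>k. x k \<in> Y" and fx: "\<And>i j. cblinfun_apply (f i) (x j) = (if i = j then 1 else 0)"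
    and g: "\<And>k y. y \<in> Y \<Longrightarrow> cblinfun_apply (g k) y = 0"
    and gz: "\<And>i j. cblinfun_apply (g i) (z j) = (if i = j then 1 else 0)"
  shows "halfspace Y"
  unfolding halfspace_def
proof (intro conjI Y notI)
  assume "finite_cdim Y"
  then obtain B where "finite B" "cspan B = Y" by (auto simp: finite_cdim_def)
  then show False
    using seq_independent_not_in_finite_span[OF seq_independent_if_biorthogonal[OF fx]] x by metis
next
  assume "finite_cdim_quotient Y"
  then obtain B where B: "finite B" "\<And>x. \<exists>b\<in>cspan B. (+) x ` Y = (+) b ` Y"
    by (auto simp: finite_cdim_quotient_def)
  have "\<exists>b\<in>cspan B. z k - b \<in> Y" for k
  proof -
    obtain b where b: "b \<in> cspan B" "(+) (z k) ` Y = (+) b ` Y" using B(2) by blast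
    have "z k \<in> (+) (z k) ` Y" using complex_vector.subspace_0[OF Y(1)] by force
    then have "z k - b \<in> Y" using b(2) by auto
    then show ?thesis using b(1) by blast
  qed
  then obtain b where b: "\<And>k. b k \<in> cspan B" "\<And>k. z k - b k \<in> Y" by metis
  have "cblinfun_apply (g i) (b j) = (if i = j then 1 else 0)" for i j
    using g[OF b(2)[of j], of i] gz[of i j] by simp
  then have "seq_independent b" by (rule seq_independent_if_biorthogonal)
  then show False using seq_independent_not_in_finite_span[OF _ B(1)] b(1) by blast
qed

lemma closed_common_kernel: "closed {x. \<forall>f\<in>S. cblinfun_apply f x = (0 :: complex)}"
proof -
  have "{x. \<forall>f\<in>S. cblinfun_apply f x = 0} = (\<Inter>f\<in>S. {x. cblinfun_apply f x = 0})" by auto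
  moreover have "closed {x. cblinfun_apply f x = (0 :: complex)}" for f :: "'a \<Rightarrow>\<^sub>C\<^sub>L complex"
    by (intro closed_Collect_eq linear_continuous_on bounded_linear_apply continuous_on_const)
  ultimately show ?thesis by (simp add: closed_INT)
qed

lemma csubspace_common_kernel: "csubspace {x. \<forall>f\<in>S. cblinfun_apply f x = (0 :: complex)}"
  by (rule complex_vector.subspaceI) auto

text \<open>The halfspace is the closed span of the even members. It is described as a double annihilator, which is
  obviously closed and is invariant because \<open>S\<close> is stable under composition with
  \<open>R\<close>.\<close>

lemma admits_IHS_if_eigenvectors:
  fixes x :: "nat \<Rightarrow> 'a::complex_normed_vector" and f :: "nat \<Rightarrow> 'a \<Rightarrow>\<^sub>C\<^sub>L complex"
  assumes R: "\<And>k. cblinfun_apply R (x k) = \<mu> k *\<^sub>C x k"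
    and fx: "\<And>i j. cblinfun_apply (f i) (x j) = (if i = j then 1 else 0)"
  shows "admits_IHS R"
proof -
  define S :: "('a \<Rightarrow>\<^sub>C\<^sub>L complex) set" where "S = {h. \<forall>k. cblinfun_apply h (x (2 * k)) = 0}"
  define Y where "Y = {y. \<forall>h\<in>S. cblinfun_apply h y = 0}"
  have "halfspace Y"
  proof (rule halfspaceI)
    show "csubspace Y" "closed Y"
      unfolding Y_def by (rule csubspace_common_kernel closed_common_kernel)+
    show "x (2 * k) \<in> Y" for k by (auto simp: Y_def S_def)
    show "cblinfun_apply (f (2 * i)) (x (2 * j)) = (if i = j then 1 else 0)" for i j
      using fx by simp
    have "f (2 * k + 1) \<in> S" for k unfolding S_def using fx by (simp, presburger)
    then show "cblinfun_apply (f (2 * k + 1)) y = 0" if "y \<in> Y" for k y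
      using that by (auto simp: Y_def)
    show "cblinfun_apply (f (2 * i + 1)) (x (2 * j + 1)) = (if i = j then 1 else 0)" for i j
      using fx by simp
  qed
  moreover have "cblinfun_apply R y \<in> Y" if y: "y \<in> Y" for y
    unfolding Y_def
  proof (intro CollectI ballI)
    fix h assume "h \<in> S"
    then have "h o\<^sub>C R \<in> S" by (simp add: S_def R)
    then show "cblinfun_apply h (cblinfun_apply R y) = 0" using y by (force simp: Y_def)
  qed
  ultimately show ?thesis unfolding admits_IHS_def by blast
qed

lemma admits_IHS_if_eigenfunctionals:
  fixes f :: "nat \<Rightarrow> 'a::complex_normed_vector \<Rightarrow>\<^sub>C\<^sub>L complex"
  assumes R: "\<And>k. f k o\<^sub>C R = \<mu> k *\<^sub>C f k"
    and fx: "\<And>i j. cblinfun_apply (f i) (x j) = (if i = j then 1 else 0)"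
  shows "admits_IHS R"
proof -
  define Y where "Y = {y. \<forall>h\<in>range (\<lambda>k. f (2 * k)). cblinfun_apply h y = 0}"
  have "halfspace Y"
  proof (rule halfspaceI)
    show "csubspace Y" "closed Y"
      unfolding Y_def by (rule csubspace_common_kernel closed_common_kernel)+
    show "x (2 * k + 1) \<in> Y" for k unfolding Y_def using fx by (simp, presburger)
    show "cblinfun_apply (f (2 * i + 1)) (x (2 * j + 1)) = (if i = j then 1 else 0)" for i j
      using fx by simp
    show "cblinfun_apply (f (2 * k)) y = 0" if "y \<in> Y" for k y
      using that by (auto simp: Y_def)
    show "cblinfun_apply (f (2 * i)) (x (2 * j)) = (if i = j then 1 else 0)" for i j
      using fx by simp
  qed
  moreover have "cblinfun_apply R y \<in> Y" if y: "y \<in> Y" for y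
  proof -
    have "cblinfun_apply (f k) (cblinfun_apply R y) = \<mu> k * cblinfun_apply (f k) y" for k
      using arg_cong[OF R[of k], of "\<lambda>h. cblinfun_apply h y"] by (simp add: scaleC_complex_def)
    then show ?thesis using y by (auto simp: Y_def)
  qed
  ultimately show ?thesis unfolding admits_IHS_def by blast
qed

text \<open>Because \<open>h k\<close> annihilates \<open>u j\<close> for \<open>k \<noteq> j\<close>, the common
  kernel of the even \<open>h k\<close> contains the odd \<open>u j\<close>. The values \<open>h k (u
  k)\<close> may vanish, so biorthogonal systems are not given here; they are obtained from the linear
  independence of eigenvectors for different eigenvalues.\<close>

lemma admits_IHS_if_common_eigenvalues:
  fixes R :: "'a::complex_banach \<Rightarrow>\<^sub>C\<^sub>L 'a" and u :: "nat \<Rightarrow> 'a"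
    and h :: "nat \<Rightarrow> 'a \<Rightarrow>\<^sub>C\<^sub>L complex"
  assumes refl: "reflexive TYPE('a)" and \<mu>: "inj \<mu>"
    and u: "\<And>k. cblinfun_apply R (u k) = \<mu> k *\<^sub>C u k" "\<And>k. u k \<noteq> 0"
    and h: "\<And>k. h k o\<^sub>C R = \<mu> k *\<^sub>C h k" "\<And>k. h k \<noteq> 0"
  shows "admits_IHS R"
proof -
  interpret X: cdual_pair "\<lambda>(x :: 'a) f. cblinfun_apply f x" by (rule cdual_pair_reflexive[OF refl])
  interpret D: cdual_pair "\<lambda>(f :: 'a \<Rightarrow>\<^sub>C\<^sub>L complex) x. cblinfun_apply f x" by (rule cdual_pair_functionals)
  define Y where "Y = {y. \<forall>f\<in>range (\<lambda>k. h (2 * k)). cblinfun_apply f y = 0}"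
  define N where "N = {f :: 'a \<Rightarrow>\<^sub>C\<^sub>L complex. \<forall>y\<in>Y. cblinfun_apply f y = 0}"
  have Y: "csubspace Y" "closed Y"
    unfolding Y_def by (rule csubspace_common_kernel closed_common_kernel)+
  have h_apply: "cblinfun_apply (h k) (cblinfun_apply R y) = \<mu> k * cblinfun_apply (h k) y" for k y
    using arg_cong[OF h(1)[of k], of "\<lambda>h. cblinfun_apply h y"] by (simp add: scaleC_complex_def)
  have hu: "cblinfun_apply (h k) (u j) = 0" if "k \<noteq> j" for k j
  proof -
    have "\<mu> j * cblinfun_apply (h k) (u j) = \<mu> k * cblinfun_apply (h k) (u j)"
      using h_apply[of k "u j"] by (simp add: u scaleC_complex_def)
    moreover have "\<mu> j \<noteq> \<mu> k" using \<mu> that by (auto simp: inj_def)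
    ultimately show ?thesis by simp
  qed
  have inj2: "inj (\<lambda>k. \<mu> (2 * k))" "inj (\<lambda>k. \<mu> (2 * k + 1))"
    by (auto intro!: injI dest!: injD[OF \<mu>])
  have "seq_independent (\<lambda>k. u (2 * k + 1))"
    by (rule seq_independent_eigenvectors[OF u(1) u(2) inj2(2)])
  moreover have "u (2 * k + 1) \<in> Y" for k
  proof -
    have "cblinfun_apply (h (2 * m)) (u (2 * k + 1)) = 0" for m by (rule hu) presburger
    then show ?thesis by (auto simp: Y_def)
  qed
  ultimately obtain x f where x: "\<And>k. x k \<in> Y" "X.biorthogonal UNIV x f"
    using X.biorthogonal_in_subspace[OF Y(1), of "\<lambda>k. u (2 * k + 1)"] by blast
  have N: "csubspace N" unfolding N_def by (rule complex_vector.subspaceI) (auto simp: scaleC_complex_def)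
  have "seq_independent (\<lambda>k. h (2 * k))"
    by (rule seq_independent_eigenvectors[where T = "cadjoint R", OF _ h(2) inj2(1)]) (simp add: h)
  moreover have "h (2 * k) \<in> N" for k by (auto simp: N_def Y_def)
  ultimately obtain g z where g: "\<And>k. g k \<in> N" "D.biorthogonal UNIV g z"
    using D.biorthogonal_in_subspace[OF N, of "\<lambda>k. h (2 * k)"] by blast
  have "halfspace Y"
  proof (rule halfspaceI[OF Y x(1)])
    show "cblinfun_apply (f i) (x j) = (if i = j then 1 else 0)" for i j
      using x(2) by (auto simp: X.biorthogonal_def)
    show "cblinfun_apply (g i) (z j) = (if i = j then 1 else 0)" for i j
      using g(2) by (auto simp: D.biorthogonal_def)
    show "cblinfun_apply (g k) y = 0" if "y \<in> Y" for k y
      using g(1)[of k] that by (auto simp: N_def)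
  qed
  moreover have "cblinfun_apply R y \<in> Y" if y: "y \<in> Y" for y
    using y h_apply by (auto simp: Y_def)
  ultimately show ?thesis unfolding admits_IHS_def by blast
qed

section \<open>Small perturbations with an invariant halfspace\<close>

definition rank_one :: "('a::complex_normed_vector \<Rightarrow>\<^sub>C\<^sub>L complex) \<Rightarrow> 'b::complex_normed_vector \<Rightarrow> ('a \<Rightarrow>\<^sub>C\<^sub>L 'b)" where
  "rank_one f y = (SOME F. \<forall>x. cblinfun_apply F x = cblinfun_apply f x *\<^sub>C y)"

lemma rank_one_apply [simp]: "cblinfun_apply (rank_one f y) x = cblinfun_apply f x *\<^sub>C y"
proof -
  have le: "norm (cblinfun_apply f x *\<^sub>C y) \<le> (norm f * norm y) * norm x" for x
    using mult_right_mono[OF norm_apply_le[of f x], of "norm y"] by (simp add: norm_scaleC mult_ac)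
  obtain F where "\<And>x. cblinfun_apply F x = cblinfun_apply f x *\<^sub>C y"
    by (rule cblinfun_ex[of "\<lambda>x. cblinfun_apply f x *\<^sub>C y", OF _ _ le])
      (auto simp: scaleC_add_left scaleC_complex_def)
  then have "\<exists>F. \<forall>x. cblinfun_apply F x = cblinfun_apply f x *\<^sub>C y" by blast
  then have "\<forall>x. cblinfun_apply (rank_one f y) x = cblinfun_apply f x *\<^sub>C y"
    unfolding rank_one_def by (rule someI_ex)
  then show ?thesis by blast
qed

lemma norm_rank_one_le: "norm (rank_one f y) \<le> norm f * norm y"
proof (rule norm_cblinfun_le)
  show "norm (cblinfun_apply (rank_one f y) x) \<le> norm f * norm y * norm x" for x
    using mult_right_mono[OF norm_apply_le[of f x], of "norm y"] by (simp add: norm_scaleC mult_ac)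
qed simp

text \<open>A uniform bound for the inverses at \<open>l n\<close> would allow a perturbation from \<open>l n\<close>
  to the limit \<open>m\<close>, so that \<open>m\<close> would lie outside the spectrum.\<close>

lemma resolvent_blowup:
  fixes T :: "'a::complex_banach \<Rightarrow>\<^sub>C\<^sub>L 'a"
  assumes m: "m \<in> cspectrum T" and l: "l \<longlonglongrightarrow> m" and R: "\<And>n. cinverse_of (R n) (T - l n *\<^sub>C cid)"
  shows "\<exists>n x. norm x > C * norm (cblinfun_apply T x - l n *\<^sub>C x)"
proof (rule ccontr)
  assume "\<not> ?thesis"
  then have le: "norm x \<le> C * norm (cblinfun_apply T x - l n *\<^sub>C x)" for n x
    by (meson not_less)
  have nR: "norm (R n) \<le> \<bar>C\<bar>" for n
  proof (rule norm_cblinfun_le)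
    have "cblinfun_apply T (cblinfun_apply (R n) y) - l n *\<^sub>C cblinfun_apply (R n) y = y" for y
      using cinverse_of_apply(2)[OF R, of n y] by simp
    then have "norm (cblinfun_apply (R n) y) \<le> C * norm y" for y
      using le[of "cblinfun_apply (R n) y" n] by simp
    also have "C * norm y \<le> \<bar>C\<bar> * norm y" for y :: 'a by (intro mult_right_mono) auto
    finally show "norm (cblinfun_apply (R n) y) \<le> \<bar>C\<bar> * norm y" for y .
  qed simp
  have "(\<lambda>n. \<bar>C\<bar> * cmod (m - l n)) \<longlonglongrightarrow> \<bar>C\<bar> * cmod (m - m)"
    by (intro tendsto_intros l)
  then have "eventually (\<lambda>n. \<bar>C\<bar> * cmod (m - l n) < 1 / 2) sequentially"
    by (rule order_tendstoD) simp
  then obtain n where n: "\<bar>C\<bar> * cmod (m - l n) < 1 / 2"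
    by (auto simp: eventually_sequentially)
  have "norm (R n) * cmod (m - l n) \<le> \<bar>C\<bar> * cmod (m - l n)"
    using nR by (intro mult_right_mono) auto
  then show False
    using cinverse_of_shift[OF R, of n m] n m by (auto simp: cspectrum_def)
qed

definition common_eigenvalue :: "('a::complex_normed_vector \<Rightarrow>\<^sub>C\<^sub>L 'a) \<Rightarrow> complex \<Rightarrow> bool" where
  "common_eigenvalue T m \<longleftrightarrow> (\<exists>x. x \<noteq> 0 \<and> cblinfun_apply T x = m *\<^sub>C x) \<and>
    (\<exists>f :: 'a \<Rightarrow>\<^sub>C\<^sub>L complex. f \<noteq> 0 \<and> f o\<^sub>C T = m *\<^sub>C f)"

lemma not_common_eigenvalue_cases:
  assumes "\<not> common_eigenvalue T m"
  obtains "\<And>x. cblinfun_apply T x = m *\<^sub>C x \<Longrightarrow> x = 0"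
  | "\<And>f :: 'a::complex_normed_vector \<Rightarrow>\<^sub>C\<^sub>L complex. f o\<^sub>C T = m *\<^sub>C f \<Longrightarrow> f = 0"
  using assms unfolding common_eigenvalue_def by blast

text \<open>If \<open>m\<close> is not an eigenvalue of \<open>T\<close>, this is \<open>rank_one_perturbation\<close>
  for \<open>X\<close> and its dual. If \<open>m\<close> is not an eigenvalue of the adjoint, the roles
  are exchanged: the adjoint is perturbed by the adjoint of a rank-one operator, whose vector
  \<open>x\<close> comes from \<open>X\<close> because \<open>X\<close> is the second space of the pair.
  The blow-up of the resolvent of \<open>T\<close> passes to the adjoint by means of norming functionals.\<close>

lemma small_rank_one_at_frontier:
  fixes T :: "'a::complex_banach \<Rightarrow>\<^sub>C\<^sub>L 'a"
  assumes refl: "reflexive TYPE('a)" and m: "m \<in> frontier (cspectrum T)"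
    and not_common: "\<not> common_eigenvalue T m"
    and e: "e > 0"
  obtains f y where "norm (rank_one f y :: 'a \<Rightarrow>\<^sub>C\<^sub>L 'a) < e" "admits_IHS (T + rank_one f y)"
proof -
  interpret X: cdual_pair "\<lambda>(x :: 'a) f. cblinfun_apply f x" by (rule cdual_pair_reflexive[OF refl])
  interpret D: cdual_pair "\<lambda>(f :: 'a \<Rightarrow>\<^sub>C\<^sub>L complex) x. cblinfun_apply f x" by (rule cdual_pair_functionals)
  have "m \<in> cspectrum T" "m \<in> closure (- cspectrum T)"
    using m closed_cspectrum[of T] by (auto simp: frontier_closures)
  then obtain l where l: "\<And>n. l n \<notin> cspectrum T" "l \<longlonglongrightarrow> m"
    by (auto simp: closure_sequential)
  then obtain R where R: "\<And>n. cinverse_of (R n) (T - l n *\<^sub>C cid)"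
    unfolding cspectrum_def by (simp, metis)
  note blowup = resolvent_blowup[OF \<open>m \<in> cspectrum T\<close> l(2) R]
  from not_common show ?thesis
  proof (cases rule: not_common_eigenvalue_cases)
    case 1
    have adj: "cblinfun_apply f (cblinfun_apply T x) = cblinfun_apply (cblinfun_apply (cadjoint T) f) x"
      for f :: "'a \<Rightarrow>\<^sub>C\<^sub>L complex" and x by simp
    have inv: "\<exists>R. cinverse_of R (T - l n *\<^sub>C cid)" for n using R by blast
    have inj': "x = 0" if "cblinfun_apply T x = m *\<^sub>C x" for x using 1 that by blast
    obtain y f a b \<mu> where *: "X.biorthogonal UNIV a b" "norm y * norm f < e"
      "\<And>k. cblinfun_apply T (a k) + cblinfun_apply f (a k) *\<^sub>C y = \<mu> k *\<^sub>C a k"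
      by (rule X.rank_one_perturbation[OF adj l(2) inv blowup inj' e]) (assumption, rule that)
    show ?thesis
    proof (rule that)
      show "norm (rank_one f y) < e" using norm_rank_one_le[of f y] *(2) by (simp add: mult.commute)
      show "admits_IHS (T + rank_one f y)"
      proof (rule admits_IHS_if_eigenvectors)
        show "cblinfun_apply (T + rank_one f y) (a k) = \<mu> k *\<^sub>C a k" for k by (simp add: *(3))
        show "cblinfun_apply (b i) (a j) = (if i = j then 1 else 0)" for i j
          using *(1) by (auto simp: X.biorthogonal_def)
      qed
    qed
  next
    case 2
    have R': "cinverse_of (cadjoint (R n)) (cadjoint T - l n *\<^sub>C cid)" for n
      unfolding cinverse_of_def
    proof (intro conjI cblinfun_eqI)
      fix f :: "'a \<Rightarrow>\<^sub>C\<^sub>L complex" and x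
      have "cblinfun_apply f (cblinfun_apply (R n) (cblinfun_apply (T - l n *\<^sub>C cid) x)) = cblinfun_apply f x"
        by (simp only: cinverse_of_apply[OF R])
      then show "cblinfun_apply (cblinfun_apply ((cadjoint T - l n *\<^sub>C cid) o\<^sub>C cadjoint (R n)) f) x
        = cblinfun_apply (cblinfun_apply cid f) x"
        by simp
      have "cblinfun_apply f (cblinfun_apply (T - l n *\<^sub>C cid) (cblinfun_apply (R n) x)) = cblinfun_apply f x"
        by (simp only: cinverse_of_apply[OF R])
      then show "cblinfun_apply (cblinfun_apply (cadjoint (R n) o\<^sub>C (cadjoint T - l n *\<^sub>C cid)) f) x
        = cblinfun_apply (cblinfun_apply cid f) x"
        by simp
    qed
    have blowup': "\<exists>n f. norm f > C * norm (cblinfun_apply (cadjoint T) f - l n *\<^sub>C f)" for C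
    proof (rule ccontr)
      assume "\<not> ?thesis"
      then have le: "norm f \<le> C * norm (cblinfun_apply (cadjoint T) f - l n *\<^sub>C f)" for n f
        by (meson not_less)
      obtain n x where nx: "norm x > \<bar>C\<bar> * norm (cblinfun_apply T x - l n *\<^sub>C x)" using blowup by blast
      obtain f :: "'a \<Rightarrow>\<^sub>C\<^sub>L complex" where f: "norm f \<le> 1" "cblinfun_apply f x = norm x"
        using norming_functional by blast
      let ?g = "f o\<^sub>C R n"
      have "cblinfun_apply (cadjoint T) ?g - l n *\<^sub>C ?g = f"
        using cinverse_of_apply(2)[OF R'[of n], of f] by simp
      then have "norm ?g \<le> C * norm f" using le[of ?g n] by simp
      also have "\<dots> \<le> \<bar>C\<bar> * 1" using f(1) by (intro mult_mono) auto
      finally have g: "norm ?g \<le> \<bar>C\<bar>" by simp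
      have "cblinfun_apply (R n) (cblinfun_apply T x - l n *\<^sub>C x) = x"
        using cinverse_of_apply(1)[OF R, of n x] by simp
      then have "cblinfun_apply ?g (cblinfun_apply T x - l n *\<^sub>C x) = norm x"
        by (simp only: apply_compose f(2))
      then have "norm x \<le> norm ?g * norm (cblinfun_apply T x - l n *\<^sub>C x)"
        using norm_apply_le[of ?g "cblinfun_apply T x - l n *\<^sub>C x"] by simp
      also have "\<dots> \<le> \<bar>C\<bar> * norm (cblinfun_apply T x - l n *\<^sub>C x)"
        using g by (intro mult_right_mono) auto
      finally show False using nx by simp
    qed
    have adj: "cblinfun_apply (cblinfun_apply (cadjoint T) f) x = cblinfun_apply f (cblinfun_apply T x)"
      for f :: "'a \<Rightarrow>\<^sub>C\<^sub>L complex" and x by simp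
    have inv: "\<exists>R. cinverse_of R (cadjoint T - l n *\<^sub>C cid)" for n using R' by blast
    have inj': "f = 0" if "cblinfun_apply (cadjoint T) f = m *\<^sub>C f" for f using 2 that by simp
    obtain y x a b \<mu> where *: "D.biorthogonal UNIV a b" "norm y * norm x < e"
      "\<And>k. cblinfun_apply (cadjoint T) (a k) + cblinfun_apply (a k) x *\<^sub>C y = \<mu> k *\<^sub>C a k"
      by (rule D.rank_one_perturbation[OF adj l(2) inv blowup' inj' e]) (assumption, rule that)
    show ?thesis
    proof (rule that)
      show "norm (rank_one y x) < e" using norm_rank_one_le[of y x] *(2) by simp
      show "admits_IHS (T + rank_one y x)"
      proof (rule admits_IHS_if_eigenfunctionals)
        show "a k o\<^sub>C (T + rank_one y x) = \<mu> k *\<^sub>C a k" for k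
        proof (rule cblinfun_eqI)
          fix v
          show "cblinfun_apply (a k o\<^sub>C (T + rank_one y x)) v = cblinfun_apply (\<mu> k *\<^sub>C a k) v"
            using arg_cong[OF *(3)[of k], of "\<lambda>h. cblinfun_apply h v"]
            by (simp add: scaleC_complex_def mult.commute)
        qed
        show "cblinfun_apply (a i) (b j) = (if i = j then 1 else 0)" for i j
          using *(1) by (auto simp: D.biorthogonal_def)
      qed
    qed
  qed
qed

text \<open>Every horizontal line close to \<open>m\<close> contains points of \<open>S\<close> and points outside,
  hence a boundary point, and different lines give different points.\<close>

lemma infinite_frontier_if_interior:
  fixes S :: "complex set"
  assumes S: "bounded S" and m: "m \<in> interior S"
  shows "infinite (frontier S)"
proof -
  obtain r where r: "r > 0" "ball m r \<subseteq> S" using m by (auto simp: mem_interior)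
  obtain K where K: "\<And>z. z \<in> S \<Longrightarrow> cmod z \<le> K" using S by (auto simp: bounded_iff)
  have "\<exists>z\<in>frontier S. Im z = Im m + s" if s: "s \<in> {0..<r}" for s
  proof -
    define L where "L = {z. Im z = Im m + s}"
    have "convex L" unfolding L_def convex_def by (auto simp flip: distrib_right)
    then have "connected L" by (rule convex_connected)
    moreover have "m + \<i> * s \<in> L \<inter> S"
      using s r(2) by (auto simp: L_def dist_norm norm_mult intro!: subsetD[OF r(2)])
    moreover have "Complex (K + 1) (Im m + s) \<in> L - S"
      using K[of "Complex (K + 1) (Im m + s)"] abs_Re_le_cmod[of "Complex (K + 1) (Im m + s)"]
      by (auto simp: L_def)
    ultimately have "L \<inter> frontier S \<noteq> {}" by (intro connected_Int_frontier) auto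
    then show ?thesis by (auto simp: L_def)
  qed
  then have "(\<lambda>s. Im m + s) ` {0..<r} \<subseteq> Im ` frontier S" by force
  moreover have "infinite ((\<lambda>s. Im m + s) ` {0..<r})"
    using r(1) by (subst finite_image_iff) (auto simp: inj_on_def)
  ultimately show ?thesis using finite_surj infinite_super finite_imageI by blast
qed

lemma bounded_cspectrum:
  fixes T :: "'a::complex_banach \<Rightarrow>\<^sub>C\<^sub>L 'a"
  shows "bounded (cspectrum T)"
proof -
  have "cmod m \<le> norm T" if "m \<in> cspectrum T" for m
    using that cinverse_of_outside[of T m] by (force simp: cspectrum_def not_le)
  then show ?thesis by (auto simp: bounded_iff)
qed

text \<open>If all boundary points of the spectrum are common eigenvalues, then \<open>m\<close> is not one of them,
  so it lies in the interior and there are infinitely many boundary points; the halfspace is then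
  invariant under \<open>T\<close> itself, and the perturbation is zero.\<close>

proposition small_rank_one_if_not_common_eigenvalue:
  fixes T :: "'a::complex_banach \<Rightarrow>\<^sub>C\<^sub>L 'a"
  assumes refl: "reflexive TYPE('a)" and m: "m \<in> cspectrum T"
    and not_common: "\<not> common_eigenvalue T m"
    and e: "e > 0"
  obtains f y where "norm (rank_one f y :: 'a \<Rightarrow>\<^sub>C\<^sub>L 'a) < e" "admits_IHS (T + rank_one f y)"
proof (cases "\<exists>n\<in>frontier (cspectrum T). \<not> common_eigenvalue T n")
  case True
  then obtain n where n: "n \<in> frontier (cspectrum T)" "\<not> common_eigenvalue T n" by (rule bexE)
  show ?thesis by (rule small_rank_one_at_frontier[OF refl n e]) (rule that)
next
  case False
  then have common: "common_eigenvalue T n" if "n \<in> frontier (cspectrum T)" for n using that by simp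
  then have "m \<notin> frontier (cspectrum T)" using not_common by auto
  then have "m \<in> interior (cspectrum T)"
    using m closed_cspectrum[of T] by (auto simp: frontier_def)
  then have "infinite (frontier (cspectrum T))"
    by (rule infinite_frontier_if_interior[OF bounded_cspectrum])
  then obtain \<mu> :: "nat \<Rightarrow> complex" where \<mu>: "inj \<mu>" "range \<mu> \<subseteq> frontier (cspectrum T)"
    using infinite_countable_subset by blast
  have common: "common_eigenvalue T (\<mu> k)" for k using \<mu>(2) by (intro common) auto
  then have "\<forall>k. \<exists>x. x \<noteq> 0 \<and> cblinfun_apply T x = \<mu> k *\<^sub>C x"
    by (simp add: common_eigenvalue_def)
  then obtain u where u: "\<And>k. cblinfun_apply T (u k) = \<mu> k *\<^sub>C u k" "\<And>k. u k \<noteq> 0" by metis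
  have "\<forall>k. \<exists>f :: 'a \<Rightarrow>\<^sub>C\<^sub>L complex. f \<noteq> 0 \<and> f o\<^sub>C T = \<mu> k *\<^sub>C f"
    using common by (simp add: common_eigenvalue_def)
  then obtain h :: "nat \<Rightarrow> 'a \<Rightarrow>\<^sub>C\<^sub>L complex" where h: "\<And>k. h k o\<^sub>C T = \<mu> k *\<^sub>C h k" "\<And>k. h k \<noteq> 0" by metis
  have "rank_one (0 :: 'a \<Rightarrow>\<^sub>C\<^sub>L complex) (0 :: 'a) = 0" by (rule cblinfun_eqI) simp
  moreover have "admits_IHS T" by (rule admits_IHS_if_common_eigenvalues[OF refl \<mu>(1) u h])
  ultimately show ?thesis using that[of 0 0] e by simp
qed

text \<open>Maximal biorthogonal systems in the space of eigenvectors and in the space of eigenfunctionals for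
  \<open>m\<close> are either infinite, which gives an invariant halfspace, or finite of lengths
  \<open>n\<close> and \<open>n'\<close>. In the second case \<open>G\<close> maps \<open>a i\<close> to
  \<open>w i\<close> for \<open>i < min n n'\<close>. The \<open>h i\<close> vanish on the range of
  \<open>T - m\<close> but separate the \<open>w i\<close>, so an eigenvector of \<open>T + d G\<close>
  for \<open>m\<close> is annihilated by those \<open>\<phi> i\<close>; if all of the \<open>\<phi>
  i\<close> occur, the eigenvector is 0 by maximality. If all of the \<open>h i\<close> occur, the dual
  argument applies. The set \<open>W\<close> does not depend on \<open>e\<close>, which bounds the rank
  uniformly.\<close>

proposition IHS_or_small_injectivity:
  fixes T :: "'a::complex_banach \<Rightarrow>\<^sub>C\<^sub>L 'a"
  assumes refl: "reflexive TYPE('a)"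
  obtains
    (invariant) "admits_IHS T"
  | (perturbation) W :: "'a set" where "finite W"
      "\<And>e. e > 0 \<Longrightarrow> \<exists>F. norm F < e \<and> range (cblinfun_apply F) \<subseteq> cspan W \<and>
        \<not> common_eigenvalue (T + F) m"
proof -
  interpret X: cdual_pair "\<lambda>(x :: 'a) f. cblinfun_apply f x" by (rule cdual_pair_reflexive[OF refl])
  interpret D: cdual_pair "\<lambda>(f :: 'a \<Rightarrow>\<^sub>C\<^sub>L complex) x. cblinfun_apply f x" by (rule cdual_pair_functionals)
  define N where "N = {x. cblinfun_apply T x = m *\<^sub>C x}"
  define N' where "N' = {f :: 'a \<Rightarrow>\<^sub>C\<^sub>L complex. f o\<^sub>C T = m *\<^sub>C f}"
  have N: "csubspace N"
    unfolding N_def by (rule complex_vector.subspaceI) (auto simp: scaleC_add_right complex_vector.scale_left_commute)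
  have "N' = {f. cblinfun_apply (cadjoint T) f = m *\<^sub>C f}" by (simp add: N'_def)
  then have N': "csubspace N'"
    by (simp only:) (rule complex_vector.subspaceI; auto simp del: cadjoint_apply simp: scaleC_add_right complex_vector.scale_left_commute)
  from N show ?thesis
  proof (cases rule: X.biorthogonal_dichotomy)
    case (infinite a b)
    have "admits_IHS T"
    proof (rule admits_IHS_if_eigenvectors)
      show "cblinfun_apply T (a k) = m *\<^sub>C a k" for k using infinite(1) by (auto simp: N_def)
      show "cblinfun_apply (b i) (a j) = (if i = j then 1 else 0)" for i j
        using infinite(2) by (auto simp: X.biorthogonal_def)
    qed
    then show ?thesis by (rule invariant)
  next
    case (finite n a \<phi>)
    note n = finite
    from N' show ?thesis
    proof (cases rule: D.biorthogonal_dichotomy)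
      case (infinite a b)
      have "admits_IHS T"
      proof (rule admits_IHS_if_eigenfunctionals)
        show "a k o\<^sub>C T = m *\<^sub>C a k" for k using infinite(1) by (auto simp: N'_def)
        show "cblinfun_apply (a i) (b j) = (if i = j then 1 else 0)" for i j
          using infinite(2) by (auto simp: D.biorthogonal_def)
      qed
      then show ?thesis by (rule invariant)
    next
      case (finite n' h w)
      define p where "p = min n n'"
      define G where "G = (\<Sum>i<p. rank_one (\<phi> i) (w i))"
      have G: "cblinfun_apply G x = (\<Sum>i<p. cblinfun_apply (\<phi> i) x *\<^sub>C w i)" for x
      proof -
        have "cblinfun_apply (\<Sum>i\<in>I. rank_one (\<phi> i) (w i)) x = (\<Sum>i\<in>I. cblinfun_apply (\<phi> i) x *\<^sub>C w i)"
          if "finite I" for I using that by (induction I) auto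
        then show ?thesis by (simp add: G_def)
      qed
      have hG: "cblinfun_apply (h j) (cblinfun_apply G x) = cblinfun_apply (\<phi> j) x" if "j < p" for j x
      proof -
        have "cblinfun_apply (h j) (w i) = (if i = j then 1 else 0)" if "i < p" for i
          using finite(2) that \<open>j < p\<close> by (auto simp: D.biorthogonal_def p_def)
        then have "cblinfun_apply (h j) (cblinfun_apply G x) = (\<Sum>i<p. if i = j then cblinfun_apply (\<phi> i) x else 0)"
          unfolding G apply_sum by (intro sum.cong) (auto simp: scaleC_complex_def)
        then show ?thesis using that by simp
      qed
      have Ga: "cblinfun_apply G (a j) = w j" if "j < p" for j
      proof -
        have "cblinfun_apply (\<phi> i) (a j) = (if i = j then 1 else 0)" if "i < p" for i
          using n(2) that \<open>j < p\<close> by (auto simp: X.biorthogonal_def p_def)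
        then have "cblinfun_apply G (a j) = (\<Sum>i<p. if i = j then w i else 0)"
          unfolding G by (intro sum.cong) auto
        then show ?thesis using that by simp
      qed
      show ?thesis
      proof (rule perturbation[of "w ` {..<p}"])
        fix e :: real assume e: "e > 0"
        define d where "d = e / (norm G + 1)"
        have pos: "norm G + 1 > 0" by (simp add: add_nonneg_pos)
        then have d: "d > 0" using e by (simp add: d_def)
        define F where "F = complex_of_real d *\<^sub>C G"
        have F: "cblinfun_apply F x = complex_of_real d *\<^sub>C cblinfun_apply G x" for x
          by (simp add: F_def)
        have "norm F = d * norm G" using d by (simp add: F_def norm_scaleC)
        also have "\<dots> < d * (norm G + 1)" using d by simp
        also have "\<dots> = e" using pos by (simp add: d_def)
        finally have small: "norm F < e" .
        have "cblinfun_apply F x \<in> cspan (w ` {..<p})" for x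
          unfolding F G
          by (intro complex_vector.span_scale complex_vector.span_sum complex_vector.span_base) auto
        then have "range (cblinfun_apply F) \<subseteq> cspan (w ` {..<p})" by blast
        moreover note small
        moreover have "\<not> common_eigenvalue (T + F) m"
        proof (cases "n \<le> n'")
          case True
          then have p: "p = n" by (simp add: p_def)
          have "x = 0" if x: "cblinfun_apply (T + F) x = m *\<^sub>C x" for x
          proof -
            have \<phi>0: "cblinfun_apply (\<phi> j) x = 0" if "j < n" for j
            proof -
              have "h j o\<^sub>C T = m *\<^sub>C h j" using finite(1)[of j] that True by (simp add: N'_def)
              from arg_cong[OF this, of "\<lambda>f. cblinfun_apply f x"] arg_cong[OF x, of "cblinfun_apply (h j)"]
              show ?thesis using d hG[of j x] that by (simp add: F p scaleC_complex_def)
            qed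
            then have "cblinfun_apply F x = 0" by (simp add: F G p)
            then have "x \<in> N" using x by (simp add: N_def)
            then show "x = 0" using \<phi>0 by (rule n(3))
          qed
          then show ?thesis by (auto simp: common_eigenvalue_def)
        next
          case False
          then have p: "p = n'" by (simp add: p_def)
          have "f = 0" if f: "f o\<^sub>C (T + F) = m *\<^sub>C f" for f :: "'a \<Rightarrow>\<^sub>C\<^sub>L complex"
          proof -
            have eq: "cblinfun_apply f (cblinfun_apply T x) + d * cblinfun_apply f (cblinfun_apply G x)
                = m * cblinfun_apply f x" for x
              using arg_cong[OF f, of "\<lambda>f. cblinfun_apply f x"] by (simp add: F scaleC_complex_def)
            have w0: "cblinfun_apply f (w j) = 0" if "j < n'" for j
            proof -
              have "cblinfun_apply T (a j) = m *\<^sub>C a j" using n(1)[of j] that False by (simp add: N_def)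
              then show ?thesis using d eq[of "a j"] Ga[of j] that by (simp add: p scaleC_complex_def)
            qed
            then have "cblinfun_apply f (cblinfun_apply G x) = 0" for x
              by (simp add: G apply_sum p scaleC_complex_def)
            then have "f \<in> N'"
              using eq by (auto simp: N'_def scaleC_complex_def intro!: cblinfun_eqI)
            then show "f = 0" using w0 by (rule finite(3))
          qed
          then show ?thesis by (auto simp: common_eigenvalue_def)
        qed
        ultimately show "\<exists>F. norm F < e \<and> range (cblinfun_apply F) \<subseteq> cspan (w ` {..<p}) \<and>
          \<not> common_eigenvalue (T + F) m" by blast
      qed simp
    qed
  qed
qed

lemma rank_leI:
  assumes W: "finite W" "card W \<le> d" and F: "range (cblinfun_apply F) \<subseteq> cspan W"
  shows "rank_le F d"
proof -
  let ?V = "range (cblinfun_apply F)"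
  have sub: "csubspace ?V"
    by (rule complex_vector.subspaceI) (auto simp: image_iff intro: exI[of _ 0] simp flip: apply_simps(1) apply_scaleC)
  obtain B where B: "B \<subseteq> ?V" "\<not> complex_vector.dependent B" "?V \<subseteq> cspan B"
    by (rule complex_vector.basis_exists)
  have "finite B" using complex_vector.independent_span_bound[OF W(1) B(2)] B(1) F by blast
  moreover have "cspan B = ?V" using B complex_vector.span_minimal[OF B(1) sub] by blast
  ultimately have "finite_cdim ?V" using B(1) by (auto simp: finite_cdim_def)
  moreover have "cdim ?V \<le> d" using complex_vector.dim_le_card[OF F W(1)] W(2) by simp
  ultimately show ?thesis by (simp add: rank_le_def)
qed

theorem corollary2p8:
  fixes T :: "'a::complex_banach \<Rightarrow>\<^sub>C\<^sub>L 'a"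
  assumes "\<not> finite_cdim (UNIV :: 'a set)"
    and "reflexive TYPE('a)"
  shows "\<exists>d::nat. 1 \<le> d \<and>
    (\<forall>\<epsilon>::real. \<epsilon> > 0 \<longrightarrow>
      (\<exists>F :: 'a \<Rightarrow>\<^sub>C\<^sub>L 'a. rank_le F d \<and> norm F < \<epsilon> \<and> admits_IHS (T + F)))"
proof -
  obtain m where m: "\<And>F. finite_rank F \<Longrightarrow> m \<in> cspectrum (T + F)"
    using weyl_spectrum_nonempty[OF assms(1)] by blast
  show ?thesis
  proof (cases rule: IHS_or_small_injectivity[where T = T and m = m, OF assms(2), case_names invariant perturbation])
    case invariant
    have "rank_le (0 :: 'a \<Rightarrow>\<^sub>C\<^sub>L 'a) 1" by (rule rank_leI[of "{}"]) auto
    then show ?thesis using invariant by (intro exI[of _ 1]) (auto intro!: exI[of _ 0])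
  next
    case (perturbation W)
    show ?thesis
    proof (intro exI[of _ "card W + 1"] conjI allI impI)
      fix e :: real assume e: "e > 0"
      then obtain F where F: "norm F < e / 2" "range (cblinfun_apply F) \<subseteq> cspan W"
        "\<not> common_eigenvalue (T + F) m"
        using perturbation(2)[of "e / 2"] by auto
      have "finite_rank F" using perturbation(1) F(2) by (auto simp: finite_rank_def)
      then have "m \<in> cspectrum (T + F)" by (rule m)
      then obtain f y where y: "norm (rank_one f y) < e / 2" "admits_IHS (T + F + rank_one f y)"
        using small_rank_one_if_not_common_eigenvalue[OF assms(2) _ F(3), of "e / 2"] e by auto
      show "\<exists>F. rank_le F (card W + 1) \<and> norm F < e \<and> admits_IHS (T + F)"
      proof (intro exI conjI)
        show "norm (F + rank_one f y) < e"
          using norm_triangle_ineq[of F "rank_one f y"] F(1) y(1) by simp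
        show "admits_IHS (T + (F + rank_one f y))" using y(2) by (simp add: add.assoc)
        show "rank_le (F + rank_one f y) (card W + 1)"
        proof (rule rank_leI[of "insert y W"])
          show "finite (insert y W)" "card (insert y W) \<le> card W + 1"
            using perturbation(1) by (auto simp: card_insert_if)
          have "cblinfun_apply F x \<in> cspan (insert y W)" for x
            using F(2) complex_vector.span_mono[of W "insert y W"] by blast
          then have "cblinfun_apply (F + rank_one f y) x \<in> cspan (insert y W)" for x
            unfolding apply_add rank_one_apply
            by (rule complex_vector.span_add[OF _ complex_vector.span_scale[OF complex_vector.span_base]]) auto
          then show "range (cblinfun_apply (F + rank_one f y)) \<subseteq> cspan (insert y W)" by blast
        qed
      qed
    qed simp
  qed
qed

end
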